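(* Let $n\ge 2$. The Intrinsic Generalized sine-Gordon equation (IGSGE) admits at least $n-1$ conservation laws, considering one of the independent variables to be the time variable. Precisely: let $\{V,h\}$ be a solution of the IGSGE on an open set $U\subset\mathbb{R}^n$ such that no $V_i$ vanishes on $U$, and let $x_\tau$ ($\tau\in\{1,\dots,n\}$) be the independent variable chosen as time. Put $\omega_k=V_k\,dx_k$, $W_{ij}=h_{ij}\,dx_j-h_{ji}\,dx_i$. For every $x^0\in U$ and every initial value $L(x^0)\in O(n)$ there is a unique $O(n)$-valued function $L$, defined locally near $x^0$ and taking this initial value, such that $$(dL\,L^t)_{1i}+(LWL^t)_{1i}+\sum_{k=1}^n L_{ik}V_k\,dx_k=0\quad (i\ge 2),\qquad (dL\,L^t)_{ij}+(LWL^t)_{ij}=0\quad (i,j\ge 2,\ i\neq j),$$ and, with $\theta=\sum_{k=1}^n L_{1k}V_k\,dx_k$, for each of the $n-1$ indices $j\ne\tau$ the $(n-1)$-form $$\psi_j=\theta\wedge\bigwedge_{k\neq \tau,\,j}dx_k$$ (wedge product over $k$ in increasing order) is closed, so that $$\frac{\partial (L_{1j}V_j)}{\partial x_\tau}-\frac{\partial (L_{1\tau}V_\tau)}{\partial x_j}=0 .$$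
   Context: The Intrinsic Generalized sine-Gordon equation (IGSGE) is the following system for a pair $\{V,h\}$ of smooth functions on an open set $U\subset\mathbb{R}^n$ with coordinates $x=(x_1,\dots,x_n)$, where $V=(V_1,\dots,V_n)$ is a vector-valued function and $h=(h_{ij})$ is an off-diagonal $n\times n$ matrix-valued function ($h_{ii}=0$), with $1\le i,j,s\le n$: $$VV^t=1,$$ $$\frac{\partial V_i}{\partial x_j}=V_j h_{ji},\qquad i\ne j,$$ $$\frac{\partial h_{ij}}{\partial x_i}+\frac{\partial h_{ji}}{\partial x_j}+\sum_{s\ne i,j}h_{si}h_{sj}=V_iV_j,\qquad i\ne j,$$ $$\frac{\partial h_{ij}}{\partial x_s}=h_{is}h_{sj},\qquad i,j,s\text{ distinct}.$$ When the $V_i$ do not vanish, $ds^2=\sum_i\omega_i^2$ with $\omega_i=V_i\,dx_i$ is a Riemannian metric on $U$ of constant sectional curvature $-1$, whose connection forms with respect to the orthonormal frame dual to $\omega_1,\dots,\omega_n$ are $\omega_{ij}=h_{ij}\,dx_j-h_{ji}\,dx_i$. A conservation law, with one independent variable $x_\tau$ regarded as time, is here a closed $(n-1)$-form $\psi_j$ associated to solutions, as written in the claim, giving a relation $\partial_{x_\tau}(\text{density})=\partial_{x_j}(\text{flux})$. $L^t$ is the transpose and $(dL)_{ij}=d(L_{ij})$. When $n=2$ the system for $L$ with $i,j\ge2$, $i\ne j$ is vacuous, and the empty wedge product is $1$. *)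

theory Defs
  imports "HOL-Analysis.Analysis"
begin

type_synonym 'n rvec = "real^'n"
type_synonym 'n rmat = "real^'n^'n"

definition partial :: "'n::finite \<Rightarrow> ('n rvec \<Rightarrow> 'b::real_normed_vector) \<Rightarrow> 'n rvec \<Rightarrow> 'b" where
  "partial k f x = vector_derivative (\<lambda>t. f (x + t *\<^sub>R axis k 1)) (at 0)"

text \<open>On an open set, all iterated partial derivatives being (Frechet) differentiable is the
  same as the function being of class \<open>C\<^sup>\<infinity>\<close>.\<close>

definition smooth_on :: "('n::finite rvec) set \<Rightarrow> ('n rvec \<Rightarrow> 'b::real_normed_vector) \<Rightarrow> bool" where
  "smooth_on S f \<longleftrightarrow> (\<forall>ks. foldr partial ks f differentiable_on S)"


text \<open>The exterior algebra of the cotangent space of \<open>\<real>\<^sup>n\<close>: the component of \<open>a\<close> at the index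
  set \<open>I = {i\<^sub>1 < \<dots> < i\<^sub>k}\<close> is the coefficient of \<open>dx\<^bsub>i\<^sub>1\<^esub> \<and> \<dots> \<and> dx\<^bsub>i\<^sub>k\<^esub>\<close> in \<open>a\<close>.
  A differential form is a function from points to this algebra.\<close>

type_synonym 'n ext = "real^('n set)"

text \<open>Sign of the permutation that sorts \<open>I\<close> followed by \<open>J\<close> (both listed increasingly),
  for disjoint \<open>I\<close> and \<open>J\<close>.\<close>

definition shuffle_sign :: "'n::linorder set \<Rightarrow> 'n set \<Rightarrow> real" where
  "shuffle_sign I J = (- 1) ^ card {(i, j). i \<in> I \<and> j \<in> J \<and> j < i}"

definition wedge :: "'n::{finite,linorder} ext \<Rightarrow> 'n ext \<Rightarrow> 'n ext" (infixr "\<and>\<^sub>w" 72) where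
  "a \<and>\<^sub>w b = (\<chi> K. \<Sum>I\<in>Pow K. shuffle_sign I (K - I) * (a $ I) * (b $ (K - I)))"

definition dx :: "'n::finite \<Rightarrow> 'n ext" where
  "dx k = axis {k} 1"

definition wedge_dx :: "'n::{finite,linorder} set \<Rightarrow> 'n ext" where
  "wedge_dx K = foldr (\<lambda>k a. dx k \<and>\<^sub>w a) (sorted_list_of_set K) (axis {} 1)"

definition differential :: "('n::finite rvec \<Rightarrow> real) \<Rightarrow> 'n rvec \<Rightarrow> 'n ext" where
  "differential f x = (\<Sum>k\<in>UNIV. partial k f x *\<^sub>R dx k)"

definition ext_deriv :: "('n::{finite,linorder} rvec \<Rightarrow> 'n ext) \<Rightarrow> 'n rvec \<Rightarrow> 'n ext" where
  "ext_deriv \<alpha> x = (\<Sum>k\<in>UNIV. dx k \<and>\<^sub>w partial k \<alpha> x)"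

definition form_on :: "('n::finite rvec) set \<Rightarrow> nat \<Rightarrow> ('n rvec \<Rightarrow> 'n ext) \<Rightarrow> bool" where
  "form_on S p \<alpha> \<longleftrightarrow> smooth_on S \<alpha> \<and> (\<forall>x\<in>S. \<forall>I. card I \<noteq> p \<longrightarrow> \<alpha> x $ I = 0)"

definition closed_form_on :: "('n::{finite,linorder} rvec) set \<Rightarrow> nat \<Rightarrow> ('n rvec \<Rightarrow> 'n ext) \<Rightarrow> bool" where
  "closed_form_on S p \<alpha> \<longleftrightarrow> form_on S p \<alpha> \<and> (\<forall>x\<in>S. ext_deriv \<alpha> x = 0)"


definition IGSGE :: "('n::finite rvec) set \<Rightarrow> ('n rvec \<Rightarrow> 'n rvec) \<Rightarrow> ('n rvec \<Rightarrow> 'n rmat) \<Rightarrow> bool" where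
  "IGSGE U V h \<longleftrightarrow>
     smooth_on U V \<and> smooth_on U h \<and>
     (\<forall>x\<in>U.
        (\<forall>i. h x $ i $ i = 0) \<and>
        (\<Sum>i\<in>UNIV. V x $ i * V x $ i) = 1 \<and>
        (\<forall>i j. i \<noteq> j \<longrightarrow> partial j (\<lambda>y. V y $ i) x = V x $ j * h x $ j $ i) \<and>
        (\<forall>i j. i \<noteq> j \<longrightarrow>
           partial i (\<lambda>y. h y $ i $ j) x + partial j (\<lambda>y. h y $ j $ i) x
             + (\<Sum>s\<in>UNIV - {i, j}. h x $ s $ i * h x $ s $ j) = V x $ i * V x $ j) \<and>
        (\<forall>i j s. i \<noteq> j \<and> j \<noteq> s \<and> i \<noteq> s \<longrightarrow>
           partial s (\<lambda>y. h y $ i $ j) x = h x $ i $ s * h x $ s $ j))"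

text \<open>The indices \<open>1, \<dots>, n\<close> are the elements of a finite linearly ordered type; this is \<open>1\<close>.\<close>

definition first :: "'n::{finite,linorder}" where
  "first = Min UNIV"

definition W_form :: "('n rvec \<Rightarrow> 'n rmat) \<Rightarrow> 'n \<Rightarrow> 'n \<Rightarrow> 'n::finite rvec \<Rightarrow> 'n ext" where
  "W_form h i j x = h x $ i $ j *\<^sub>R dx j - h x $ j $ i *\<^sub>R dx i"

text \<open>Row \<open>i\<close> of \<open>L \<omega>\<close>, where \<open>\<omega>\<^sub>k = V\<^sub>k dx\<^sub>k\<close>.\<close>

definition theta_form ::
  "('n rvec \<Rightarrow> 'n rvec) \<Rightarrow> ('n rvec \<Rightarrow> 'n rmat) \<Rightarrow> 'n \<Rightarrow> 'n::finite rvec \<Rightarrow> 'n ext" where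
  "theta_form V L i x = (\<Sum>k\<in>UNIV. (L x $ i $ k * V x $ k) *\<^sub>R dx k)"

definition dLLt :: "('n rvec \<Rightarrow> 'n rmat) \<Rightarrow> 'n \<Rightarrow> 'n \<Rightarrow> 'n::finite rvec \<Rightarrow> 'n ext" where
  "dLLt L i j x = (\<Sum>k\<in>UNIV. transpose (L x) $ k $ j *\<^sub>R differential (\<lambda>y. L y $ i $ k) x)"

definition LWLt ::
  "('n rvec \<Rightarrow> 'n rmat) \<Rightarrow> ('n rvec \<Rightarrow> 'n rmat) \<Rightarrow> 'n \<Rightarrow> 'n \<Rightarrow> 'n::finite rvec \<Rightarrow> 'n ext" where
  "LWLt h L i j x =
     (\<Sum>k\<in>UNIV. \<Sum>l\<in>UNIV. (L x $ i $ k * transpose (L x) $ l $ j) *\<^sub>R W_form h k l x)"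

definition L_system ::
  "('n::{finite,linorder} rvec) set \<Rightarrow> ('n rvec \<Rightarrow> 'n rvec) \<Rightarrow> ('n rvec \<Rightarrow> 'n rmat)
     \<Rightarrow> ('n rvec \<Rightarrow> 'n rmat) \<Rightarrow> bool" where
  "L_system N V h L \<longleftrightarrow>
     L differentiable_on N \<and>
     (\<forall>x\<in>N.
        orthogonal_matrix (L x) \<and>
        (\<forall>i. i \<noteq> first \<longrightarrow>
           dLLt L first i x + LWLt h L first i x + theta_form V L i x = 0) \<and>
        (\<forall>i j. i \<noteq> first \<and> j \<noteq> first \<and> i \<noteq> j \<longrightarrow>
           dLLt L i j x + LWLt h L i j x = 0))"

definition psi_form ::
  "('n rvec \<Rightarrow> 'n rvec) \<Rightarrow> ('n rvec \<Rightarrow> 'n rmat) \<Rightarrow> 'n \<Rightarrow> 'n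
     \<Rightarrow> 'n::{finite,linorder} rvec \<Rightarrow> 'n ext" where
  "psi_form V L \<tau> j x = theta_form V L first x \<and>\<^sub>w wedge_dx (UNIV - {\<tau>, j})"

end

theory Submission
  imports Defs
begin

text \<open>Along any orthogonal matrix field \<open>L\<close> the equations for \<open>L\<close> determine all of \<open>dL\<close>: expanding
\<open>dL\<^sub>i\<close> in the orthonormal basis formed by the rows \<open>L\<^sub>1, \<dots>, L\<^sub>n\<close> they become
  \<open>\<partial>\<^sub>s L\<^sub>i = V\<^sub>s L\<^sub>i\<^sub>s L\<^sub>1 - \<delta>\<^sub>i\<^sub>1 V\<^sub>s e\<^sub>s - spin\<^sub>s L\<^sub>i\<close>,
where \<open>spin\<^sub>s\<close> is a skew matrix built from \<open>h\<close> (\<open>L_system_iff_frame_system\<close>).  The first row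
satisfies a closed Riccati equation, and the others are linear once the first is known.

Existence.  The equations are the projective form of a linear system.  Constant curvature \<open>-1\<close> says
that the \<open>so(n,1)\<close>-valued connection on the rank \<open>n+1\<close> bundle of the hyperboloid model is flat;
\<open>conn_mat\<close> is its matrix, and the IGSGE yields its flatness (\<open>conn_mat_flat\<close>).
A parallel section \<open>(p, q)\<close> with \<open>p(x\<^sub>0) = L\<^sub>1(x\<^sub>0)\<close>, \<open>q(x\<^sub>0) = 1\<close> gives \<open>L\<^sub>1 = p/q\<close>, and parallel
sections \<open>(r\<^sub>i, c\<^sub>i)\<close> with \<open>r\<^sub>i(x\<^sub>0) = L\<^sub>i(x\<^sub>0)\<close>, \<open>c\<^sub>i(x\<^sub>0) = 0\<close> give \<open>L\<^sub>i = r\<^sub>i - c\<^sub>i L\<^sub>1\<close>.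
Since parallel transport preserves the Minkowski product, \<open>L\<close> stays orthogonal.

Flat linear systems \<open>\<partial>\<^sub>s Y = A\<^sub>s Y\<close> are solved by Picard iteration along rays from \<open>x\<^sub>0\<close>
(\<open>flat_linear_system_solvable\<close>).  The radial integral is the homotopy operator of the
Poincare lemma, so by flatness the defects \<open>E\<^sub>k = dY\<^sub>k - A Y\<^sub>k\<close> satisfy
\<open>E\<^sub>k\<^sub>+\<^sub>1 = A (Y\<^sub>k - Y\<^sub>k\<^sub>+\<^sub>1) + K (A \<and> E\<^sub>k)\<close>, where \<open>K\<close> integrates two-forms radially.  On a small ball
this forces \<open>E\<^sub>k \<rightarrow> 0\<close> uniformly, and the limit solves the system.  Smoothness of \<open>L\<close> follows because its
partial derivatives are polynomials in \<open>V\<close>, \<open>h\<close> and \<open>L\<close>.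

Uniqueness.  For two solutions, \<open>u = 1 - L\<^sub>1 \<bullet> L'\<^sub>1\<close> satisfies \<open>\<partial>\<^sub>s u = V\<^sub>s (L\<^sub>1\<^sub>s + L'\<^sub>1\<^sub>s) u\<close>, so it vanishes
on a connected set; then the products \<open>L\<^sub>i \<bullet> L'\<^sub>i\<close> of the other rows are constant.

Closedness.  By the frame equations \<open>\<partial>\<^sub>\<tau> (L\<^sub>1\<^sub>j V\<^sub>j)\<close> is symmetric in \<open>j\<close> and \<open>\<tau>\<close>, and \<open>d\<psi>\<^sub>j\<close> is, up to
sign, the difference of the two mixed derivatives times the volume form.\<close>

section \<open>Partial derivatives as gradients\<close>

text \<open>\<open>has_grad f p x\<close>: the function \<open>f\<close> is Frechet differentiable at \<open>x\<close> and its \<open>l\<close>-th partial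
derivative there is \<open>p l\<close>.\<close>

definition has_grad :: "('n::finite rvec \<Rightarrow> 'b::real_normed_vector) \<Rightarrow> ('n \<Rightarrow> 'b) \<Rightarrow> 'n rvec \<Rightarrow> bool" where
  "has_grad f p x \<longleftrightarrow> (f has_derivative (\<lambda>v. \<Sum>l\<in>UNIV. v $ l *\<^sub>R p l)) (at x)"

lemma sum_axis_scaleR:
  fixes p :: "'n::finite \<Rightarrow> 'b::real_vector"
  shows "(\<Sum>l\<in>UNIV. (axis k (1::real)) $ l *\<^sub>R p l) = p k"
proof -
  have "(\<Sum>l\<in>UNIV. (axis k (1::real)) $ l *\<^sub>R p l) = (\<Sum>l\<in>UNIV. if l = k then p l else 0)"
    by (rule sum.cong) (auto simp: axis_def)
  then show ?thesis by simp
qed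

lemma has_derivative_along_axis:
  assumes "(f has_derivative D) (at x)"
  shows "((\<lambda>t. f (x + t *\<^sub>R axis k 1)) has_vector_derivative D (axis k 1)) (at 0)"
proof -
  interpret bounded_linear D using assms by (rule has_derivative_bounded_linear)
  have "((\<lambda>t::real. x + t *\<^sub>R axis k 1) has_derivative (\<lambda>t. t *\<^sub>R axis k 1)) (at 0)"
    by (auto intro!: derivative_eq_intros)
  then have "((f \<circ> (\<lambda>t::real. x + t *\<^sub>R axis k 1)) has_derivative (D \<circ> (\<lambda>t. t *\<^sub>R axis k 1))) (at 0)"
    by (rule diff_chain_at) (simp add: assms)
  then show ?thesis by (simp add: has_vector_derivative_def o_def scaleR)
qed

lemma partial_has_derivative:
  "(f has_derivative D) (at x) \<Longrightarrow> partial k f x = D (axis k 1)"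
  unfolding partial_def by (intro vector_derivative_at has_derivative_along_axis)

lemma has_grad_partial: "has_grad f p x \<Longrightarrow> partial k f x = p k"
  unfolding has_grad_def by (drule partial_has_derivative[where k=k]) (simp add: sum_axis_scaleR)

lemma differentiable_has_grad:
  assumes "f differentiable (at x)"
  shows "has_grad f (\<lambda>k. partial k f x) x"
proof -
  obtain D where D: "(f has_derivative D) (at x)"
    using assms by (auto simp: differentiable_def)
  interpret bounded_linear D using D by (rule has_derivative_bounded_linear)
  have "D v = (\<Sum>l\<in>UNIV. v $ l *\<^sub>R partial l f x)" for v
  proof -
    have "D v = D (\<Sum>l\<in>UNIV. v $ l *\<^sub>R axis l 1)"
      by (simp flip: scalar_mult_eq_scaleR add: basis_expansion)
    then show ?thesis by (simp add: sum scaleR partial_has_derivative[OF D])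
  qed
  then have "D = (\<lambda>v. \<Sum>l\<in>UNIV. v $ l *\<^sub>R partial l f x)" by auto
  then show ?thesis using D by (simp add: has_grad_def)
qed

lemma has_grad_differentiable: "has_grad f p x \<Longrightarrow> f differentiable (at x)"
  by (auto simp: has_grad_def differentiable_def)

lemma has_grad_continuous_on:
  "(\<And>x. x \<in> S \<Longrightarrow> has_grad f (p x) x) \<Longrightarrow> continuous_on S f"
  unfolding has_grad_def by (meson continuous_at_imp_continuous_on has_derivative_continuous)

lemma has_grad_cong_open:
  assumes "has_grad f p x" "open S" "x \<in> S" "\<And>y. y \<in> S \<Longrightarrow> f y = g y"
  shows "has_grad g p x"
  using assms unfolding has_grad_def by (blast intro: has_derivative_transform_within_open)

lemma has_grad_const: "has_grad (\<lambda>_. c) (\<lambda>_. 0) x"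
  by (simp add: has_grad_def)

lemma has_grad_add:
  assumes "has_grad f p x" "has_grad g q x"
  shows "has_grad (\<lambda>y. f y + g y) (\<lambda>l. p l + q l) x"
  using has_derivative_add[OF assms[unfolded has_grad_def]]
  by (simp add: has_grad_def scaleR_right_distrib sum.distrib)

lemma has_grad_bounded_linear:
  assumes "bounded_linear T" "has_grad f p x"
  shows "has_grad (\<lambda>y. T (f y)) (\<lambda>l. T (p l)) x"
proof -
  interpret bounded_linear T by fact
  show ?thesis using bounded_linear.has_derivative[OF assms(1) assms(2)[unfolded has_grad_def]]
    by (simp add: has_grad_def sum scaleR)
qed

lemma has_grad_bounded_bilinear:
  assumes "bounded_bilinear B" "has_grad f p x" "has_grad g q x"
  shows "has_grad (\<lambda>y. B (f y) (g y)) (\<lambda>l. B (p l) (g x) + B (f x) (q l)) x"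
proof -
  interpret bounded_bilinear B by fact
  show ?thesis
    using FDERIV[OF assms(2,3)[unfolded has_grad_def]]
    by (simp add: has_grad_def sum_left sum_right scaleR_left scaleR_right sum.distrib
          scaleR_right_distrib add.commute)
qed

lemma has_grad_sum:
  assumes "\<And>i. i \<in> I \<Longrightarrow> has_grad (f i) (p i) x"
  shows "has_grad (\<lambda>y. \<Sum>i\<in>I. f i y) (\<lambda>l. \<Sum>i\<in>I. p i l) x"
proof -
  have "((\<lambda>y. \<Sum>i\<in>I. f i y) has_derivative (\<lambda>v. \<Sum>i\<in>I. \<Sum>l\<in>UNIV. v $ l *\<^sub>R p i l)) (at x)"
    using assms by (intro has_derivative_sum) (auto simp: has_grad_def)
  then show ?thesis
    unfolding has_grad_def
    by (subst (asm) sum.swap) (simp add: scaleR_sum_right)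
qed

lemma has_grad_diff:
  assumes "has_grad f p x" "has_grad g q x"
  shows "has_grad (\<lambda>y. f y - g y) (\<lambda>l. p l - q l) x"
  using has_grad_add[OF assms(1) has_grad_bounded_linear[OF bounded_linear_minus[OF bounded_linear_ident] assms(2)]]
  by simp

lemma has_grad_nth: "has_grad f p x \<Longrightarrow> has_grad (\<lambda>y. f y $ i) (\<lambda>l. p l $ i) x"
  by (rule has_grad_bounded_linear[OF bounded_linear_vec_nth])

lemma bounded_linear_axis: "bounded_linear (axis i :: 'b::euclidean_space \<Rightarrow> 'b^'m::finite)"
  by (auto intro!: linear_conv_bounded_linear[THEN iffD1] linearI simp: vec_eq_iff axis_def)

lemma has_grad_vec:
  fixes f :: "'n::finite rvec \<Rightarrow> 'b::euclidean_space^'m"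
  assumes "\<And>i. has_grad (\<lambda>y. f y $ i) (p i) x"
  shows "has_grad f (\<lambda>l. \<chi> i. p i l) x"
proof -
  have sum: "(\<Sum>i\<in>UNIV. axis i (z $ i)) = z" for z :: "'b^'m"
    by (simp add: vec_eq_iff axis_def sum.delta')
  from has_grad_sum[of UNIV, OF has_grad_bounded_linear[OF bounded_linear_axis assms]]
  have "has_grad (\<lambda>y. \<Sum>i\<in>UNIV. axis i (f y $ i)) (\<lambda>l. \<Sum>i\<in>UNIV. axis i (p i l)) x" .
  then show ?thesis using sum[of "\<chi> i. p i _"] by (simp add: sum)
qed

lemma has_grad_component: "has_grad (\<lambda>y. (y - x0) $ k) (\<lambda>l. if l = k then 1 else 0) x"
proof -
  have "((\<lambda>y. (y - x0) $ k) has_derivative (\<lambda>v. v $ k)) (at x)"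
    by (auto intro!: derivative_eq_intros bounded_linear.has_derivative[OF bounded_linear_vec_nth])
  moreover have "(\<Sum>l\<in>UNIV. v $ l * (if l = k then 1 else 0)) = v $ k" for v :: "real^'a"
    by (subst sum.mono_neutral_right[of UNIV "{k}"]) auto
  ultimately show ?thesis by (simp add: has_grad_def)
qed

lemma has_grad_inverse:
  fixes f :: "'n::finite rvec \<Rightarrow> real"
  assumes "has_grad f p x" "f x \<noteq> 0"
  shows "has_grad (\<lambda>y. inverse (f y)) (\<lambda>k. - (inverse (f x) * inverse (f x)) * p k) x"
proof -
  have "((\<lambda>y. inverse (f y)) has_derivative
      (\<lambda>v. - (inverse (f x) * (\<Sum>k\<in>UNIV. v $ k *\<^sub>R p k) * inverse (f x)))) (at x)"
    using assms unfolding has_grad_def by (intro Deriv.has_derivative_inverse)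
  then show ?thesis
    by (simp add: has_grad_def sum_distrib_left sum_distrib_right sum_negf mult_ac)
qed

lemma bounded_bilinear_matrix_vector_mult:
  "bounded_bilinear ((*v) :: real^'m^'k \<Rightarrow> real^'m \<Rightarrow> real^'k)"
  by (auto intro!: bilinear_conv_bounded_bilinear[THEN iffD1] linearI
      simp: bilinear_def matrix_vector_mult_add_rdistrib matrix_vector_right_distrib
        scaleR_matrix_vector_assoc matrix_vector_mult_scaleR)

section \<open>Iterated differentiability\<close>

text \<open>All iterated partial derivatives of order at most \<open>m\<close> are differentiable.  This is the
stratification of smoothness by order along which its closure properties are proved by induction.\<close>

definition diff_order :: "nat \<Rightarrow> ('n::finite rvec) set \<Rightarrow> ('n rvec \<Rightarrow> 'b::real_normed_vector) \<Rightarrow> bool" where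
  "diff_order m S f \<longleftrightarrow> (\<forall>ks. length ks \<le> m \<longrightarrow> foldr partial ks f differentiable_on S)"

lemma smooth_on_iff: "smooth_on S f \<longleftrightarrow> (\<forall>m. diff_order m S f)"
  by (auto simp: smooth_on_def diff_order_def)

lemma diff_order_0: "diff_order 0 S f \<longleftrightarrow> f differentiable_on S"
  by (auto simp: diff_order_def)

lemma diff_order_Suc:
  "diff_order (Suc m) S f \<longleftrightarrow> f differentiable_on S \<and> (\<forall>k. diff_order m S (partial k f))"
proof (intro iffI conjI allI)
  assume *: "diff_order (Suc m) S f"
  show "f differentiable_on S"
    using *[unfolded diff_order_def, rule_format, of "[]"] by simp
  show "diff_order m S (partial k f)" for k
    unfolding diff_order_def
  proof (intro allI impI)
    fix ks :: "'a list" assume "length ks \<le> m"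
    then show "foldr partial ks (partial k f) differentiable_on S"
      using *[unfolded diff_order_def, rule_format, of "ks @ [k]"] by simp
  qed
next
  assume *: "f differentiable_on S \<and> (\<forall>k. diff_order m S (partial k f))"
  show "diff_order (Suc m) S f"
    unfolding diff_order_def
  proof (intro allI impI)
    fix ks :: "'a list" assume l: "length ks \<le> Suc m"
    show "foldr partial ks f differentiable_on S"
    proof (cases ks rule: rev_cases)
      case Nil then show ?thesis using * by simp
    next
      case (snoc ks' k)
      then show ?thesis using * l by (simp add: diff_order_def)
    qed
  qed
qed

lemma diff_order_imp_differentiable: "diff_order m S f \<Longrightarrow> f differentiable_on S"
  by (cases m) (auto simp: diff_order_0 diff_order_Suc)

lemma diff_order_mono: "diff_order (Suc m) S f \<Longrightarrow> diff_order m S f"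
  by (auto simp: diff_order_def)

lemma partial_cong_open:
  assumes "open S" "x \<in> S" "\<And>y. y \<in> S \<Longrightarrow> f y = g y"
  shows "partial k f x = partial k g x"
proof -
  have "\<forall>\<^sub>F t in nhds 0. x + t *\<^sub>R axis k 1 \<in> S"
  proof -
    have "((\<lambda>t::real. x + t *\<^sub>R axis k 1) \<longlongrightarrow> x + 0 *\<^sub>R axis k 1) (nhds 0)"
      by (intro tendsto_intros filterlim_ident)
    then show ?thesis using assms(1,2) by (simp add: topological_tendstoD)
  qed
  then have ev: "\<forall>\<^sub>F t in nhds 0. f (x + t *\<^sub>R axis k 1) = g (x + t *\<^sub>R axis k 1)"
    by eventually_elim (simp add: assms(3))
  show ?thesis
    unfolding partial_def
    by (rule vector_derivative_cong_eq) (use ev in auto)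
qed

lemma diff_order_cong:
  assumes "open S" "\<And>x. x \<in> S \<Longrightarrow> f x = g x" "diff_order m S f"
  shows "diff_order m S g"
  using assms(2,3)
proof (induction m arbitrary: f g)
  case 0
  then show ?case by (simp add: diff_order_0 differentiable_on_def)
      (metis differentiable_transform_within zero_less_one)
next
  case (Suc m)
  have "diff_order m S (partial k g)" for k
  proof (rule Suc.IH)
    show "partial k f x = partial k g x" if "x \<in> S" for x
      using partial_cong_open[OF assms(1) that] Suc.prems(1) by blast
    show "diff_order m S (partial k f)" using Suc.prems by (simp add: diff_order_Suc)
  qed
  moreover have "g differentiable_on S"
    using Suc.prems by (simp add: diff_order_Suc differentiable_on_def)
      (metis differentiable_transform_within zero_less_one)
  ultimately show ?case by (simp add: diff_order_Suc)
qed

lemma differentiable_on_has_grad: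
  assumes "open S" "x \<in> S" "f differentiable_on S"
  shows "has_grad f (\<lambda>k. partial k f x) x"
  using assms by (auto intro!: differentiable_has_grad simp: differentiable_on_eq_differentiable_at)

lemma diff_order_SucI:
  assumes "open S" "\<And>x. x \<in> S \<Longrightarrow> has_grad f (\<lambda>k. p k x) x" "\<And>k. diff_order m S (p k)"
  shows "diff_order (Suc m) S f"
proof -
  have "f differentiable_on S"
    using assms(1,2) by (auto simp: differentiable_on_eq_differentiable_at intro: has_grad_differentiable)
  moreover have "diff_order m S (partial k f)" for k
    by (rule diff_order_cong[OF assms(1) _ assms(3)[of k]]) (simp add: has_grad_partial[OF assms(2)])
  ultimately show ?thesis by (simp add: diff_order_Suc)
qed

lemma diff_order_has_grad:
  "diff_order m S f \<Longrightarrow> open S \<Longrightarrow> x \<in> S \<Longrightarrow> has_grad f (\<lambda>k. partial k f x) x"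
  by (auto intro: differentiable_on_has_grad diff_order_imp_differentiable)

lemma diff_order_const: "open S \<Longrightarrow> diff_order m S (\<lambda>_. c)"
proof (induction m arbitrary: c)
  case (Suc m)
  then show ?case by (auto intro!: diff_order_SucI[where p = "\<lambda>_ _. 0"] has_grad_const)
qed (simp add: diff_order_0)

lemma diff_order_bounded_linear:
  assumes "open S" "bounded_linear T" "diff_order m S f"
  shows "diff_order m S (\<lambda>x. T (f x))"
  using assms(3)
proof (induction m arbitrary: f)
  case 0
  then show ?case
    using assms has_grad_bounded_linear[OF assms(2) diff_order_has_grad[OF 0 assms(1)]]
    by (auto simp: diff_order_0 differentiable_on_eq_differentiable_at intro: has_grad_differentiable)
next
  case (Suc m)
  have "diff_order m S (\<lambda>x. T (partial k f x))" for k
    using Suc by (simp add: diff_order_Suc)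
  then show ?case
    using has_grad_bounded_linear[OF assms(2) diff_order_has_grad[OF Suc.prems assms(1)]]
    by (intro diff_order_SucI[OF assms(1)])
qed

lemma diff_order_add:
  assumes "open S" "diff_order m S f" "diff_order m S g"
  shows "diff_order m S (\<lambda>x. f x + g x)"
  using assms(2,3)
proof (induction m arbitrary: f g)
  case 0
  then show ?case by (auto simp: diff_order_0 intro: differentiable_on_add)
next
  case (Suc m)
  have "diff_order m S (\<lambda>x. partial k f x + partial k g x)" for k
    using Suc by (simp add: diff_order_Suc)
  then show ?case
    using has_grad_add[OF diff_order_has_grad[OF Suc.prems(1) assms(1)]
      diff_order_has_grad[OF Suc.prems(2) assms(1)]]
    by (intro diff_order_SucI[OF assms(1)])
qed

lemma diff_order_bounded_bilinear:
  assumes "open S" "bounded_bilinear B" "diff_order m S f" "diff_order m S g"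
  shows "diff_order m S (\<lambda>x. B (f x) (g x))"
  using assms(3,4)
proof (induction m arbitrary: f g)
  case 0
  then show ?case
    using has_grad_bounded_bilinear[OF assms(2) diff_order_has_grad[OF 0(1) assms(1)]
        diff_order_has_grad[OF 0(2) assms(1)]] assms(1)
    by (auto simp: diff_order_0 differentiable_on_eq_differentiable_at intro: has_grad_differentiable)
next
  case (Suc m)
  show ?case
  proof (rule diff_order_SucI[OF assms(1)])
    show "has_grad (\<lambda>x. B (f x) (g x)) (\<lambda>k. B (partial k f x) (g x) + B (f x) (partial k g x)) x"
      if "x \<in> S" for x
      using that Suc.prems assms(1)
      by (intro has_grad_bounded_bilinear[OF assms(2)] diff_order_has_grad)
    show "diff_order m S (\<lambda>x. B (partial k f x) (g x) + B (f x) (partial k g x))" for k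
    proof (intro diff_order_add[OF assms(1)] Suc.IH)
      show "diff_order m S (partial k f)" "diff_order m S (partial k g)"
        using Suc.prems by (simp_all add: diff_order_Suc)
    qed (use Suc.prems diff_order_mono in blast)+
  qed
qed

lemma diff_order_sum:
  assumes "open S" "finite I" "\<And>i. i \<in> I \<Longrightarrow> diff_order m S (f i)"
  shows "diff_order m S (\<lambda>x. \<Sum>i\<in>I. f i x)"
  using assms(2,3) by (induction I) (auto intro!: diff_order_add diff_order_const assms(1))

lemma diff_order_diff:
  assumes "open S" "diff_order m S f" "diff_order m S g"
  shows "diff_order m S (\<lambda>x. f x - g x)"
  using diff_order_add[OF assms(1,2) diff_order_bounded_linear[OF assms(1)
      bounded_linear_minus[OF bounded_linear_ident] assms(3)]] by simp

lemma diff_order_nth: "open S \<Longrightarrow> diff_order m S f \<Longrightarrow> diff_order m S (\<lambda>x. f x $ i)"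
  by (rule diff_order_bounded_linear[OF _ bounded_linear_vec_nth])

lemma diff_order_mult:
  fixes f g :: "'n::finite rvec \<Rightarrow> real"
  shows "open S \<Longrightarrow> diff_order m S f \<Longrightarrow> diff_order m S g \<Longrightarrow> diff_order m S (\<lambda>x. f x * g x)"
  by (rule diff_order_bounded_bilinear[OF _ bounded_bilinear_mult])

lemma diff_order_scaleR:
  "open S \<Longrightarrow> diff_order m S f \<Longrightarrow> diff_order m S g \<Longrightarrow> diff_order m S (\<lambda>x. f x *\<^sub>R g x)"
  by (rule diff_order_bounded_bilinear[OF _ bounded_bilinear_scaleR])

lemma diff_order_vec:
  fixes f :: "'m::finite \<Rightarrow> 'n::finite rvec \<Rightarrow> 'b::euclidean_space"
  assumes "open S" "\<And>i. diff_order m S (f i)"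
  shows "diff_order m S (\<lambda>x. \<chi> i. f i x)"
proof -
  have "(\<chi> i. f i x) = (\<Sum>i\<in>UNIV. axis i (f i x))" for x
    by (simp add: vec_eq_iff axis_def)
  then show ?thesis
    by (simp add: diff_order_sum assms diff_order_bounded_linear[OF assms(1) bounded_linear_axis])
qed

lemma smooth_on_subset: "smooth_on S f \<Longrightarrow> T \<subseteq> S \<Longrightarrow> smooth_on T f"
  unfolding smooth_on_def using differentiable_on_subset by blast

lemma smooth_on_differentiable:
  assumes "smooth_on S f"
  shows "f differentiable_on S" "partial k f differentiable_on S"
  using assms[unfolded smooth_on_def, rule_format, of "[]"] assms[unfolded smooth_on_def, rule_format, of "[k]"]
  by auto

section \<open>Radial integration of one-forms\<close>

text \<open>The integral of the one-form \<open>\<Sum>\<^sub>k \<alpha>\<^sub>k dx\<^sub>k\<close> along the segment from \<open>x0\<close> to \<open>x\<close>; as a function of \<open>x\<close>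
this is the homotopy operator in the proof of the Poincare lemma.\<close>

definition radial_integral :: "'n::finite rvec \<Rightarrow> ('n \<Rightarrow> 'n rvec \<Rightarrow> 'b::banach) \<Rightarrow> 'n rvec \<Rightarrow> 'b" where
  "radial_integral x0 \<alpha> x =
     integral {0..1} (\<lambda>t. \<Sum>k\<in>UNIV. (x - x0) $ k *\<^sub>R \<alpha> k (x0 + t *\<^sub>R (x - x0)))"

text \<open>The derivative with partial derivatives \<open>p l\<close>, as a bounded linear function.\<close>

definition grad_blinfun :: "('n::finite \<Rightarrow> 'b::real_normed_vector) \<Rightarrow> 'n rvec \<Rightarrow>\<^sub>L 'b" where
  "grad_blinfun p = (\<Sum>l\<in>UNIV. blinfun_scaleR_left (p l) o\<^sub>L blinfun_inner_left (axis l 1))"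

lemma grad_blinfun_apply: "blinfun_apply (grad_blinfun p) v = (\<Sum>l\<in>UNIV. v $ l *\<^sub>R p l)"
  by (simp add: grad_blinfun_def blinfun.sum_left inner_axis)

lemma segment_in_convex:
  assumes "convex S" "x0 \<in> S" "x \<in> S" "t \<in> {0..1::real}"
  shows "x0 + t *\<^sub>R (x - x0) \<in> S"
proof -
  have "x0 + t *\<^sub>R (x - x0) = (1 - t) *\<^sub>R x0 + t *\<^sub>R x" by (simp add: algebra_simps)
  then show ?thesis using assms convexD_alt[of S x0 x t] by simp
qed

lemma continuous_on_radial:
  fixes x0 :: "'a::real_normed_vector"
  assumes "convex S" "x0 \<in> S" "continuous_on S f"
  shows "continuous_on (S \<times> {0..1}) (\<lambda>(x, t::real). f (x0 + t *\<^sub>R (x - x0)))"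
proof -
  have "continuous_on (S \<times> {0..1}) (\<lambda>z. f (x0 + snd z *\<^sub>R (fst z - x0)))"
    by (rule continuous_on_compose2[OF assms(3)])
      (auto intro!: continuous_intros segment_in_convex[OF assms(1,2)])
  then show ?thesis by (simp add: case_prod_beta)
qed

lemma continuous_on_radial_line:
  fixes x0 :: "'a::real_normed_vector"
  assumes "convex S" "x0 \<in> S" "x \<in> S" "continuous_on S f"
  shows "continuous_on {0..1} (\<lambda>t::real. f (x0 + t *\<^sub>R (x - x0)))"
  by (rule continuous_on_compose2[OF assms(4)])
      (use assms in \<open>auto intro!: continuous_intros segment_in_convex[OF assms(1,2)]\<close>)

lemma has_grad_radial:
  assumes "has_grad f p (x0 + t *\<^sub>R (x - x0))"
  shows "has_grad (\<lambda>y. f (x0 + t *\<^sub>R (y - x0))) (\<lambda>l. t *\<^sub>R p l) x"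
proof -
  have "((\<lambda>y. x0 + t *\<^sub>R (y - x0)) has_derivative (\<lambda>v. t *\<^sub>R v)) (at x)"
    by (auto intro!: derivative_eq_intros)
  from has_derivative_compose[OF this assms[unfolded has_grad_def]]
  show ?thesis by (simp add: has_grad_def mult.commute)
qed

lemma has_vector_derivative_radial:
  assumes "has_grad f p (x0 + t *\<^sub>R (x - x0))"
  shows "((\<lambda>t. f (x0 + t *\<^sub>R (x - x0))) has_vector_derivative (\<Sum>l\<in>UNIV. (x - x0) $ l *\<^sub>R p l)) (at t within T)"
proof -
  have "((\<lambda>t. x0 + t *\<^sub>R (x - x0)) has_derivative (\<lambda>s. s *\<^sub>R (x - x0))) (at t within T)"
    by (auto intro!: derivative_eq_intros)
  from has_derivative_compose[OF this assms[unfolded has_grad_def]]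
  show ?thesis by (simp add: has_vector_derivative_def scaleR_sum_right)
qed

text \<open>The homotopy formula \<open>d(K \<alpha>) = \<alpha> - K (d\<alpha>)\<close>, in coordinates; the sign of the second summand is
absorbed in the order of the two partial derivatives.\<close>

lemma radial_integral_has_grad:
  fixes \<alpha> :: "'n::finite \<Rightarrow> 'n rvec \<Rightarrow> 'b::banach"
  assumes S: "open S" "convex S" "x0 \<in> S" and x: "x \<in> S"
    and grad: "\<And>k x. x \<in> S \<Longrightarrow> has_grad (\<alpha> k) (\<lambda>l. d\<alpha> l k x) x"
    and cont: "\<And>l k. continuous_on S (d\<alpha> l k)"
  shows "has_grad (radial_integral x0 \<alpha>) (\<lambda>l. \<alpha> l x + integral {0..1} (\<lambda>t. t *\<^sub>R
     (\<Sum>k\<in>UNIV. (x - x0) $ k *\<^sub>R (d\<alpha> l k (x0 + t *\<^sub>R (x - x0)) - d\<alpha> k l (x0 + t *\<^sub>R (x - x0)))))) x"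
    and "continuous_on S (\<lambda>x. \<alpha> l x + integral {0..1} (\<lambda>t. t *\<^sub>R
     (\<Sum>k\<in>UNIV. (x - x0) $ k *\<^sub>R (d\<alpha> l k (x0 + t *\<^sub>R (x - x0)) - d\<alpha> k l (x0 + t *\<^sub>R (x - x0))))))"
proof -
  define \<gamma> where "\<gamma> x t = x0 + t *\<^sub>R (x - x0)" for x and t :: real
  have \<gamma>: "\<gamma> y t \<in> S" if "y \<in> S" "t \<in> {0..1}" for y t
    unfolding \<gamma>_def using segment_in_convex[OF S(2,3) that] .
  have cont\<alpha>: "continuous_on S (\<alpha> k)" for k
    by (rule has_grad_continuous_on[OF grad])
  define P where "P l x t = \<alpha> l (\<gamma> x t) + (\<Sum>k\<in>UNIV. (x - x0) $ k *\<^sub>R (t *\<^sub>R d\<alpha> l k (\<gamma> x t)))" for l x t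
  have comp: "continuous_on (S \<times> {0..1}) (\<lambda>z. f (\<gamma> (fst z) (snd z)))" if "continuous_on S f"
    for f :: "'n rvec \<Rightarrow> 'b"
    using continuous_on_radial[OF S(2,3) that] by (simp add: \<gamma>_def case_prod_beta)
  have line: "continuous_on {0..1} (\<lambda>t. f (\<gamma> y t))" if "continuous_on S f" "y \<in> S"
    for f :: "'n rvec \<Rightarrow> 'b" and y
    using continuous_on_radial_line[OF S(2,3) that(2,1)] by (simp add: \<gamma>_def)
  have Pgrad: "has_grad (\<lambda>y. \<Sum>k\<in>UNIV. (y - x0) $ k *\<^sub>R \<alpha> k (\<gamma> y t)) (\<lambda>l. P l y t) y"
    if "y \<in> S" "t \<in> {0..1}" for y t
  proof -
    have "has_grad (\<lambda>y. \<Sum>k\<in>UNIV. (y - x0) $ k *\<^sub>R \<alpha> k (\<gamma> y t))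
       (\<lambda>l. \<Sum>k\<in>UNIV. (if l = k then 1 else 0) *\<^sub>R \<alpha> k (\<gamma> y t) + (y - x0) $ k *\<^sub>R (t *\<^sub>R d\<alpha> l k (\<gamma> y t))) y"
      unfolding \<gamma>_def
      by (intro has_grad_sum has_grad_bounded_bilinear[OF bounded_bilinear_scaleR]
           has_grad_component has_grad_radial grad[unfolded \<gamma>_def])
        (use \<gamma>[OF that] in \<open>simp add: \<gamma>_def\<close>)
    moreover have "(\<Sum>k\<in>UNIV. (if l = k then 1 else 0) *\<^sub>R \<alpha> k (\<gamma> y t) + (y - x0) $ k *\<^sub>R (t *\<^sub>R d\<alpha> l k (\<gamma> y t))) = P l y t" for l
    proof -
      have "(\<Sum>k\<in>UNIV. (if l = k then 1 else 0) *\<^sub>R \<alpha> k (\<gamma> y t)) = \<alpha> l (\<gamma> y t)"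
        by (subst sum.mono_neutral_right[of UNIV "{l}"]) auto
      then show ?thesis by (simp add: P_def sum.distrib)
    qed
    ultimately show ?thesis by simp
  qed
  have contP: "continuous_on (S \<times> {0..1}) (\<lambda>z. P l (fst z) (snd z))" for l
    unfolding P_def by (intro continuous_intros comp cont cont\<alpha>)
  have lineP: "continuous_on {0..1} (P l y)" if "y \<in> S" for l y
    unfolding P_def by (intro continuous_intros line cont cont\<alpha> that)
  have lineF: "(\<lambda>t. \<Sum>k\<in>UNIV. (y - x0) $ k *\<^sub>R \<alpha> k (\<gamma> y t)) integrable_on {0..1}" if "y \<in> S" for y
    by (intro integrable_continuous_real continuous_intros line cont\<alpha> that)
  have "((\<lambda>y. integral (cbox 0 1) (\<lambda>t. \<Sum>k\<in>UNIV. (y - x0) $ k *\<^sub>R \<alpha> k (\<gamma> y t))) has_derivative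
        integral (cbox 0 1) (\<lambda>t. grad_blinfun (\<lambda>l. P l x t))) (at x within S)"
  proof (rule leibniz_rule)
    show "((\<lambda>y. \<Sum>k\<in>UNIV. (y - x0) $ k *\<^sub>R \<alpha> k (\<gamma> y t)) has_derivative
         grad_blinfun (\<lambda>l. P l y t)) (at y within S)" if "y \<in> S" "t \<in> cbox 0 1" for y t
      using Pgrad[of y t] that unfolding has_grad_def
      by (simp add: has_derivative_at_withinI grad_blinfun_apply[abs_def])
    show "continuous_on (S \<times> cbox 0 1) (\<lambda>(x, t). grad_blinfun (\<lambda>l. P l x t))"
      unfolding grad_blinfun_def case_prod_beta
      by (intro continuous_intros bounded_linear.continuous_on[OF bounded_linear_blinfun_scaleR_left])
        (use contP in simp)
  qed (use lineF x S in auto)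
  then have "(radial_integral x0 \<alpha> has_derivative
        integral {0..1} (\<lambda>t. grad_blinfun (\<lambda>l. P l x t))) (at x)"
    by (simp add: at_within_open[OF x S(1)] radial_integral_def[abs_def] \<gamma>_def)
  moreover have "blinfun_apply (integral {0..1} (\<lambda>t. grad_blinfun (\<lambda>l. P l x t)))
      = (\<lambda>v. \<Sum>l\<in>UNIV. v $ l *\<^sub>R integral {0..1} (P l x))"
  proof
    fix v
    have "continuous_on {0..1} (\<lambda>t. grad_blinfun (\<lambda>l. P l x t))"
      unfolding grad_blinfun_def
      by (intro continuous_intros bounded_linear.continuous_on[OF bounded_linear_blinfun_scaleR_left]
           lineP[OF x])
    then have "integral {0..1} (\<lambda>t. grad_blinfun (\<lambda>l. P l x t)) v = integral {0..1} (\<lambda>t. grad_blinfun (\<lambda>l. P l x t) v)"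
      by (intro blinfun_apply_integral integrable_continuous_real)
    also have "\<dots> = (\<Sum>l\<in>UNIV. integral {0..1} (\<lambda>t. v $ l *\<^sub>R P l x t))"
      unfolding grad_blinfun_apply
      by (intro integral_sum integrable_continuous_real continuous_intros lineP[OF x]) auto
    finally show "integral {0..1} (\<lambda>t. grad_blinfun (\<lambda>l. P l x t)) v
      = (\<Sum>l\<in>UNIV. v $ l *\<^sub>R integral {0..1} (P l x))" by simp
  qed
  ultimately have g: "has_grad (radial_integral x0 \<alpha>) (\<lambda>l. integral {0..1} (P l x)) x"
    by (simp add: has_grad_def)
  have eq: "integral {0..1} (P l y) = \<alpha> l y + integral {0..1} (\<lambda>t. t *\<^sub>R
     (\<Sum>k\<in>UNIV. (y - x0) $ k *\<^sub>R (d\<alpha> l k (\<gamma> y t) - d\<alpha> k l (\<gamma> y t))))" if y: "y \<in> S" for l y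
  proof -
    \<comment> \<open>\<open>Q\<close> is the derivative of \<open>t \<alpha>\<^sub>l(\<gamma> t)\<close>, so its integral is \<open>\<alpha>\<^sub>l\<close> at the endpoint.\<close>
    define Q where "Q t = t *\<^sub>R (\<Sum>k\<in>UNIV. (y - x0) $ k *\<^sub>R d\<alpha> k l (\<gamma> y t)) + \<alpha> l (\<gamma> y t)" for t
    have "(Q has_integral (1 *\<^sub>R \<alpha> l (\<gamma> y 1) - 0 *\<^sub>R \<alpha> l (\<gamma> y 0))) {0..1}"
    proof (rule fundamental_theorem_of_calculus)
      fix t :: real assume t: "t \<in> {0..1}"
      have "((\<lambda>t. \<alpha> l (\<gamma> y t)) has_vector_derivative (\<Sum>k\<in>UNIV. (y - x0) $ k *\<^sub>R d\<alpha> k l (\<gamma> y t))) (at t within {0..1})"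
        unfolding \<gamma>_def by (rule has_vector_derivative_radial[OF grad])
          (use \<gamma>[OF y t] in \<open>simp add: \<gamma>_def\<close>)
      then show "((\<lambda>t. t *\<^sub>R \<alpha> l (\<gamma> y t)) has_vector_derivative Q t) (at t within {0..1})"
        unfolding Q_def
        by (auto intro!: derivative_eq_intros)
    qed simp
    then have "(Q has_integral \<alpha> l y) {0..1}" by (simp add: \<gamma>_def)
    moreover have "(P l y has_integral integral {0..1} (P l y)) {0..1}"
      by (intro integrable_integral integrable_continuous_real lineP y)
    ultimately have "((\<lambda>t. P l y t - Q t) has_integral (integral {0..1} (P l y) - \<alpha> l y)) {0..1}"
      by (intro has_integral_diff)
    moreover have "P l y t - Q t = t *\<^sub>R (\<Sum>k\<in>UNIV. (y - x0) $ k *\<^sub>R (d\<alpha> l k (\<gamma> y t) - d\<alpha> k l (\<gamma> y t)))" for t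
      by (simp add: P_def Q_def scaleR_sum_right scaleR_diff_right sum_subtractf mult.commute)
    ultimately show ?thesis by (simp add: integral_unique)
  qed
  show "has_grad (radial_integral x0 \<alpha>) (\<lambda>l. \<alpha> l x + integral {0..1} (\<lambda>t. t *\<^sub>R
     (\<Sum>k\<in>UNIV. (x - x0) $ k *\<^sub>R (d\<alpha> l k (x0 + t *\<^sub>R (x - x0)) - d\<alpha> k l (x0 + t *\<^sub>R (x - x0)))))) x"
    using g eq[OF x] by (simp add: \<gamma>_def)
  have "continuous_on S (\<lambda>y. integral (cbox 0 1) (P l y))"
    using contP[of l] by (intro integral_continuous_on_param) (simp add: case_prod_beta)
  then show "continuous_on S (\<lambda>x. \<alpha> l x + integral {0..1} (\<lambda>t. t *\<^sub>R
     (\<Sum>k\<in>UNIV. (x - x0) $ k *\<^sub>R (d\<alpha> l k (x0 + t *\<^sub>R (x - x0)) - d\<alpha> k l (x0 + t *\<^sub>R (x - x0))))))"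
    by (rule continuous_on_eq) (simp add: eq \<gamma>_def)
qed

section \<open>Flat linear systems\<close>

lemma norm_sum_component_le:
  fixes w :: "real^'n" and z :: "'n::finite \<Rightarrow> 'b::real_normed_vector"
  assumes "\<And>k. norm (z k) \<le> B"
  shows "norm (\<Sum>k\<in>UNIV. w $ k *\<^sub>R z k) \<le> real CARD('n) * norm w * B"
proof -
  have "norm (w $ k *\<^sub>R z k) \<le> norm w * B" for k
    using assms[of k] component_le_norm_cart[of w k] by (simp add: mult_mono')
  then have "norm (\<Sum>k\<in>UNIV. w $ k *\<^sub>R z k) \<le> (\<Sum>k\<in>(UNIV::'n set). norm w * B)"
    by (intro sum_norm_le)
  then show ?thesis by simp
qed

text \<open>A linear total differential system whose mixed second derivatives agree formally (\<open>flat\<close>) has,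
on some ball around \<open>x0\<close> that does not depend on the initial value, a solution for every initial value.\<close>

theorem flat_linear_system_solvable:
  fixes A :: "'n::finite \<Rightarrow> 'n rvec \<Rightarrow> real^'m^'m"
  assumes U: "open U" "x0 \<in> U"
    and grad: "\<And>s x. x \<in> U \<Longrightarrow> has_grad (A s) (\<lambda>l. dA l s x) x"
    and cont: "\<And>l s. continuous_on U (dA l s)"
    and flat: "\<And>l s x. x \<in> U \<Longrightarrow> dA l s x + A s x ** A l x = dA s l x + A l x ** A s x"
  obtains r where "0 < r" "ball x0 r \<subseteq> U"
    "\<And>y0. \<exists>Y. Y x0 = y0 \<and> (\<forall>x\<in>ball x0 r. has_grad Y (\<lambda>s. A s x *v Y x) x)"
proof -
  obtain r0 where r0: "0 < r0" "cball x0 r0 \<subseteq> U"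
    using U open_contains_cball by blast
  have contA: "continuous_on U (A s)" for s
    by (rule has_grad_continuous_on[OF grad])
  obtain C where C: "0 < C" "\<And>s x y. x \<in> cball x0 r0 \<Longrightarrow> norm (A s x *v y) \<le> C * norm y"
  proof -
    have "compact ((\<lambda>x. \<Sum>s\<in>UNIV. norm (A s x)) ` cball x0 r0)"
      using contA r0(2) by (intro compact_continuous_image continuous_intros compact_cball)
        (blast intro: continuous_on_subset)
    then have "bounded ((\<lambda>x. \<Sum>s\<in>UNIV. norm (A s x)) ` cball x0 r0)"
      by (rule compact_imp_bounded)
    then obtain B where "\<forall>z\<in>(\<lambda>x. \<Sum>s\<in>UNIV. norm (A s x)) ` cball x0 r0. norm z \<le> B"
      unfolding bounded_iff by blast
    then have B: "norm (\<Sum>s\<in>UNIV. norm (A s x)) \<le> B" if "x \<in> cball x0 r0" for x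
      using that by blast
    obtain K where K: "K > 0" "\<And>(M::real^'m^'m) y. norm (M *v y) \<le> norm M * norm y * K"
      using bounded_bilinear.pos_bounded[OF bounded_bilinear_matrix_vector_mult] by blast
    show thesis
    proof (rule that[of "(\<bar>B\<bar> + 1) * K"])
      show "0 < (\<bar>B\<bar> + 1) * K" using K by simp
      fix s x and y :: "real^'m" assume x: "x \<in> cball x0 r0"
      have "norm (A s x) \<le> (\<Sum>s\<in>UNIV. norm (A s x))"
        by (rule member_le_sum) auto
      also have "\<dots> \<le> \<bar>B\<bar> + 1" using B[OF x] by simp
      finally have "norm (A s x) * (norm y * K) \<le> (\<bar>B\<bar> + 1) * (norm y * K)"
        using K by (intro mult_right_mono) auto
      then show "norm (A s x *v y) \<le> (\<bar>B\<bar> + 1) * K * norm y"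
        using K(2)[of "A s x" y] by (simp add: mult_ac)
    qed
  qed
  define N where "N = real CARD('n)"
  have N: "N > 0" by (simp add: N_def)
  \<comment> \<open>On a ball of this radius the Picard map contracts by \<open>1/8\<close>, and the recursion for the
    defects \<open>E\<close> below contracts by \<open>1/4\<close>, up to a geometrically decaying source term.\<close>
  define r where "r = min r0 (1 / (8 * N * C))"
  have r: "0 < r" "r \<le> r0" using r0 C N by (auto simp: r_def)
  have NCr: "N * r * C \<le> 1/8"
  proof -
    have "r * (8 * N * C) \<le> 1"
      using C N by (simp add: r_def pos_le_divide_eq[symmetric])
    then show ?thesis by (simp add: mult_ac)
  qed
  define S where "S = ball x0 r"
  have S: "open S" "convex S" "x0 \<in> S" using r by (auto simp: S_def)
  have SU: "S \<subseteq> U" using r r0 by (force simp: S_def)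
  have bound: "norm (A s x *v y) \<le> C * norm y" if "x \<in> S" for s x y
    using C(2) r that by (auto simp: S_def)
  have radius: "norm (x - x0) \<le> r" if "x \<in> S" for x
    using that by (simp add: S_def dist_norm norm_minus_commute)
  have line: "x0 + t *\<^sub>R (x - x0) \<in> S" if "x \<in> S" "t \<in> {0..1}" for x t
    using segment_in_convex[OF S(2,3) that] .
  have contAS: "continuous_on S (A s)" "continuous_on S (dA l s)" for l s
    using contA cont SU continuous_on_subset by blast+
  note mv = bounded_bilinear.continuous_on[OF bounded_bilinear_matrix_vector_mult]
  have int_bound: "norm (radial_integral x0 \<alpha> x) \<le> N * r * B"
    if "x \<in> S" "\<And>s. continuous_on S (\<alpha> s)" "\<And>s x. x \<in> S \<Longrightarrow> norm (\<alpha> s x) \<le> B" for \<alpha> :: "'n \<Rightarrow> 'n rvec \<Rightarrow> real^'m" and x B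
  proof -
    have B0: "0 \<le> B" using that(3)[OF that(1)] norm_ge_zero order_trans by blast
    have "norm (radial_integral x0 \<alpha> x) \<le> N * r * B * (1 - 0)"
      unfolding radial_integral_def
    proof (rule integral_bound)
      show "continuous_on {0..1} (\<lambda>t. \<Sum>k\<in>UNIV. (x - x0) $ k *\<^sub>R \<alpha> k (x0 + t *\<^sub>R (x - x0)))"
        by (intro continuous_intros continuous_on_radial_line[OF S(2,3) that(1,2)])
      fix t :: real assume "t \<in> {0..1}"
      then have "norm (\<Sum>k\<in>UNIV. (x - x0) $ k *\<^sub>R \<alpha> k (x0 + t *\<^sub>R (x - x0))) \<le> N * norm (x - x0) * B"
        unfolding N_def by (intro norm_sum_component_le that(3) line that(1))
      also have "\<dots> \<le> N * r * B"
        using N B0 radius[OF that(1)] by (intro mult_right_mono mult_left_mono) auto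
      finally show "norm (\<Sum>k\<in>UNIV. (x - x0) $ k *\<^sub>R \<alpha> k (x0 + t *\<^sub>R (x - x0))) \<le> N * r * B" .
    qed simp
    then show ?thesis by simp
  qed
  have ex: "\<exists>Y. Y x0 = y0 \<and> (\<forall>x\<in>S. has_grad Y (\<lambda>s. A s x *v Y x) x)" for y0
  proof -
    define Y where "Y = rec_nat (\<lambda>_. y0) (\<lambda>_ Yk x. y0 + radial_integral x0 (\<lambda>s x. A s x *v Yk x) x)"
    have Y_simps: "Y 0 = (\<lambda>_. y0)" "Y (Suc k) = (\<lambda>x. y0 + radial_integral x0 (\<lambda>s x. A s x *v Y k x) x)" for k
      by (simp_all add: Y_def)
    \<comment> \<open>\<open>D k\<close> are the partial derivatives of \<open>Y k\<close>, computed by the homotopy formula.\<close>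
    define dAY where "dAY k D l s x = dA l s x *v Y k x + A s x *v D l x" for k D l s x
    define D where "D = rec_nat (\<lambda>s x. 0) (\<lambda>k Dk s x. A s x *v Y k x + integral {0..1} (\<lambda>t. t *\<^sub>R
        (\<Sum>m\<in>UNIV. (x - x0) $ m *\<^sub>R (dAY k Dk s m (x0 + t *\<^sub>R (x - x0)) - dAY k Dk m s (x0 + t *\<^sub>R (x - x0))))))"
    have D_simps: "D 0 = (\<lambda>s x. 0)" "D (Suc k) = (\<lambda>s x. A s x *v Y k x + integral {0..1} (\<lambda>t. t *\<^sub>R
        (\<Sum>m\<in>UNIV. (x - x0) $ m *\<^sub>R (dAY k (D k) s m (x0 + t *\<^sub>R (x - x0)) - dAY k (D k) m s (x0 + t *\<^sub>R (x - x0))))))" for k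
      by (simp_all add: D_def)
    have YD: "(\<forall>x\<in>S. has_grad (Y k) (\<lambda>l. D k l x) x) \<and> (\<forall>l. continuous_on S (D k l))" for k
    proof (induction k)
      case 0
      then show ?case by (simp add: Y_simps D_simps has_grad_const)
    next
      case (Suc k)
      then have gY: "has_grad (Y k) (\<lambda>l. D k l x) x" if "x \<in> S" for x using that by blast
      have cD: "continuous_on S (D k l)" for l using Suc by blast
      have g: "has_grad (\<lambda>x. A s x *v Y k x) (\<lambda>l. dAY k (D k) l s x) x" if "x \<in> S" for s x
        unfolding dAY_def using that SU
        by (intro has_grad_bounded_bilinear[OF bounded_bilinear_matrix_vector_mult grad gY]) auto
      have c: "continuous_on S (dAY k (D k) l s)" for l s
        unfolding dAY_def
        by (intro continuous_intros mv contAS cD has_grad_continuous_on[OF gY])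
      note R = radial_integral_has_grad[where \<alpha> = "\<lambda>s x. A s x *v Y k x" and d\<alpha> = "dAY k (D k)", OF S _ g c]
      show ?case
      proof (intro conjI ballI allI)
        fix x assume "x \<in> S"
        from has_grad_add[OF has_grad_const[of y0] R(1)[OF this]]
        show "has_grad (Y (Suc k)) (\<lambda>l. D (Suc k) l x) x"
          by (simp add: Y_simps D_simps)
      next
        show "continuous_on S (D (Suc k) l)" for l
          using R(2)[OF S(3)] by (simp add: D_simps)
      qed
    qed
    have contY: "continuous_on S (Y k)" for k
      by (rule has_grad_continuous_on[where p = "\<lambda>x l. D k l x"]) (use YD in blast)
    have contD: "continuous_on S (D k l)" for k l
      using YD by blast
    have contAY: "continuous_on S (\<lambda>x. A s x *v Y k x)" for s k
      by (intro mv contAS contY)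
    \<comment> \<open>The defect of the \<open>k\<close>-th iterate in the differential system.\<close>
    define E where "E k s x = D k s x - A s x *v Y k x" for k s x
    have contE: "continuous_on S (E k s)" for k s
      unfolding E_def by (intro continuous_intros contD contAY)
    have Ydiff: "norm (Y (Suc k) x - Y k x) \<le> norm y0 * (1/8)^k" if "x \<in> S" for k x
      using that
    proof (induction k arbitrary: x)
      case 0
      have "norm (Y 1 x - Y 0 x) = norm (radial_integral x0 (\<lambda>s x. A s x *v y0) x)"
        by (simp add: Y_simps)
      also have "\<dots> \<le> N * r * (C * norm y0)"
        using contAY[of _ 0] by (intro int_bound 0 bound) (simp_all add: Y_simps)
      also have "\<dots> \<le> 1/8 * norm y0"
        using mult_right_mono[OF NCr norm_ge_zero[of y0]] by (simp add: mult_ac)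
      also have "\<dots> \<le> norm y0" by simp
      finally show ?case by simp
    next
      case (Suc k)
      have int: "(\<lambda>t. \<Sum>m\<in>UNIV. (x - x0) $ m *\<^sub>R
          (A m (x0 + t *\<^sub>R (x - x0)) *v Y j (x0 + t *\<^sub>R (x - x0)))) integrable_on {0..1}" for j
        by (intro integrable_continuous_real continuous_intros
             continuous_on_radial_line[OF S(2,3) Suc.prems contAY])
      have "Y (Suc (Suc k)) x - Y (Suc k) x = radial_integral x0 (\<lambda>s x. A s x *v Y (Suc k) x) x - radial_integral x0 (\<lambda>s x. A s x *v Y k x) x"
        by (simp add: Y_simps(2)[of "Suc k"] Y_simps(2)[of k])
      also have "\<dots> = radial_integral x0 (\<lambda>s x. A s x *v (Y (Suc k) x - Y k x)) x"
        unfolding radial_integral_def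
        by (subst integral_diff[OF int int, symmetric], rule integral_cong)
          (simp add: matrix_vector_mult_diff_distrib sum_subtractf scaleR_diff_right
            del: vector_minus_component)
      also have "norm \<dots> \<le> N * r * (C * (norm y0 * (1/8)^k))"
      proof (intro int_bound Suc.prems)
        show "continuous_on S (\<lambda>x. A s x *v (Y (Suc k) x - Y k x))" for s
          by (intro mv contAS continuous_intros contY)
        show "norm (A s x *v (Y (Suc k) x - Y k x)) \<le> C * (norm y0 * (1/8)^k)" if "x \<in> S" for s x
          using bound[OF that] Suc.IH[OF that] C(1)
          by (blast intro: order_trans[OF _ mult_left_mono] less_imp_le)
      qed
      also have "\<dots> \<le> 1/8 * (norm y0 * (1/8)^k)"
        using mult_right_mono[OF NCr, of "norm y0 * (1/8)^k"] by (simp add: mult_ac)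
      finally show ?case by (simp add: mult_ac)
    qed
    have Ebound: "norm (E k s x) \<le> 4 * C * norm y0 * (1/2)^k" if "x \<in> S" for k s x
      using that
    proof (induction k arbitrary: s x)
      case 0
      have "norm (E 0 s x) \<le> C * norm y0"
        using bound[OF 0] by (simp add: E_def D_simps Y_simps)
      also have "\<dots> \<le> 4 * C * norm y0" using C by simp
      finally show ?case by simp
    next
      case (Suc k)
      let ?I = "\<lambda>t. t *\<^sub>R (\<Sum>m\<in>UNIV. (x - x0) $ m *\<^sub>R
        (A m (x0 + t *\<^sub>R (x - x0)) *v E k s (x0 + t *\<^sub>R (x - x0))
          - A s (x0 + t *\<^sub>R (x - x0)) *v E k m (x0 + t *\<^sub>R (x - x0))))"
      define B where "B = 4 * C * norm y0 * (1/2)^k"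
      have B0: "B \<ge> 0" using C by (simp add: B_def)
      \<comment> \<open>Flatness turns the exterior derivative of \<open>A Y\<^sub>k\<close> into \<open>- A \<and> E\<^sub>k\<close>.\<close>
      have "dAY k (D k) s m z - dAY k (D k) m s z = A m z *v E k s z - A s z *v E k m z" if "z \<in> S" for m z
      proof -
        have "(dA s m z + A m z ** A s z) *v Y k z = (dA m s z + A s z ** A m z) *v Y k z"
          using flat[of z s m] that SU by auto
        then show ?thesis
          by (simp add: dAY_def E_def matrix_vector_mult_add_rdistrib matrix_vector_mult_diff_distrib
            matrix_vector_mul_assoc algebra_simps)
      qed
      then have "integral {0..1} (\<lambda>t. t *\<^sub>R
        (\<Sum>m\<in>UNIV. (x - x0) $ m *\<^sub>R (dAY k (D k) s m (x0 + t *\<^sub>R (x - x0)) - dAY k (D k) m s (x0 + t *\<^sub>R (x - x0)))))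
        = integral {0..1} ?I"
        using line[OF Suc.prems] by (intro integral_cong) simp
      then have EI: "E (Suc k) s x = A s x *v (Y k x - Y (Suc k) x) + integral {0..1} ?I"
        by (simp add: E_def D_simps matrix_vector_mult_diff_distrib)
      have "norm (A s x *v (Y k x - Y (Suc k) x)) \<le> C * (norm y0 * (1/8)^k)"
        using Ydiff[OF Suc.prems, of k] C(1)
        by (intro order_trans[OF bound[OF Suc.prems] mult_left_mono])
          (simp_all add: norm_minus_commute)
      also have "\<dots> \<le> C * (norm y0 * (1/2)^k)"
        using C by (intro mult_left_mono power_mono) auto
      finally have first_term: "norm (A s x *v (Y k x - Y (Suc k) x)) \<le> 1/4 * B"
        by (simp add: B_def)
      have "norm (integral {0..1} ?I) \<le> N * r * (2 * C * B) * (1 - 0)"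
      proof (rule integral_bound)
        show "continuous_on {0..1} ?I"
          by (intro continuous_intros mv continuous_on_radial_line[OF S(2,3) Suc.prems] contAS contE)
        fix t :: real assume t: "t \<in> {0..1}"
        define z where "z = x0 + t *\<^sub>R (x - x0)"
        have z: "z \<in> S" unfolding z_def by (rule line[OF Suc.prems t])
        have "norm (A m z *v E k s z - A s z *v E k m z) \<le> 2 * C * B" for m
        proof -
          have "norm (A m z *v E k s z) \<le> C * B" "norm (A s z *v E k m z) \<le> C * B"
            using bound[OF z] Suc.IH[OF z] C(1) unfolding B_def
            by (blast intro: order_trans[OF _ mult_left_mono] less_imp_le)+
          then show ?thesis using norm_triangle_ineq4[of "A m z *v E k s z" "A s z *v E k m z"] by simp
        qed
        then have "norm (\<Sum>m\<in>UNIV. (x - x0) $ m *\<^sub>R (A m z *v E k s z - A s z *v E k m z)) \<le> N * norm (x - x0) * (2 * C * B)"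
          unfolding N_def by (rule norm_sum_component_le)
        also have "\<dots> \<le> N * r * (2 * C * B)"
          using N B0 C radius[OF Suc.prems] by (intro mult_right_mono mult_left_mono) auto
        finally have *: "norm (\<Sum>m\<in>UNIV. (x - x0) $ m *\<^sub>R (A m z *v E k s z - A s z *v E k m z)) \<le> N * r * (2 * C * B)" .
        have "norm (?I t) \<le> norm (\<Sum>m\<in>UNIV. (x - x0) $ m *\<^sub>R (A m z *v E k s z - A s z *v E k m z))"
          using t by (simp add: z_def mult_left_le_one_le)
        then show "norm (?I t) \<le> N * r * (2 * C * B)" using * by linarith
      qed simp
      also have "N * r * (2 * C * B) * (1 - 0) \<le> 1/4 * B"
        using mult_right_mono[OF NCr B0] by (simp add: mult_ac)
      finally have "norm (E (Suc k) s x) \<le> 1/4 * B + 1/4 * B"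
        unfolding EI using first_term norm_triangle_ineq
        by (intro order_trans[OF norm_triangle_ineq add_mono])
      then show ?case by (simp add: B_def)
    qed
    \<comment> \<open>The iterates converge uniformly and their derivatives converge uniformly to \<open>A Y\<close>.\<close>
    have "uniform_limit S (\<lambda>n x. \<Sum>i<n. Y (Suc i) x - Y i x) (\<lambda>x. \<Sum>i. Y (Suc i) x - Y i x) sequentially"
      by (rule Weierstrass_m_test[OF Ydiff]) (auto intro!: summable_mult summable_geometric)
    then have "uniform_limit S (\<lambda>n x. Y n x - y0) (\<lambda>x. \<Sum>i. Y (Suc i) x - Y i x) sequentially"
      unfolding sum_lessThan_telescope[where f = "\<lambda>i. Y i _"] by (simp add: Y_simps(1))
    then obtain Z where Z: "uniform_limit S (\<lambda>n x. Y n x - y0) Z sequentially" by blast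
    define Yl where "Yl x = y0 + Z x" for x
    have lim: "uniform_limit S Y Yl sequentially"
      using Z unfolding uniform_limit_iff Yl_def
      by (simp add: dist_norm algebra_simps)
    have Yx0: "Y k x0 = y0" for k
      by (cases k) (simp_all add: Y_simps radial_integral_def)
    have "\<exists>g. \<forall>x\<in>S. (\<lambda>n. Y n x) \<longlonglongrightarrow> g x \<and>
        (g has_derivative (\<lambda>v. \<Sum>l\<in>UNIV. v $ l *\<^sub>R (A l x *v Yl x))) (at x within S)"
    proof (rule has_derivative_sequence[OF S(2)])
      show "(Y n has_derivative (\<lambda>v. \<Sum>l\<in>UNIV. v $ l *\<^sub>R D n l x)) (at x within S)" if "x \<in> S" for n x
        using YD that by (auto simp: has_grad_def intro: has_derivative_at_withinI)
      show "(\<lambda>n. Y n x0) \<longlonglongrightarrow> y0" by (simp add: Yx0)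
      fix e :: real assume e: "e > 0"
      have "(\<lambda>n. 4 * C * norm y0 * (1/2)^n) \<longlonglongrightarrow> 4 * C * norm y0 * 0"
        by (intro tendsto_intros LIMSEQ_power_zero) auto
      then have e1: "\<forall>\<^sub>F n in sequentially. 4 * C * norm y0 * (1/2)^n < e / (2 * N)"
        using e N by (intro order_tendstoD) auto
      have e2: "\<forall>\<^sub>F n in sequentially. \<forall>x\<in>S. dist (Y n x) (Yl x) < e / (2 * N * C)"
        using lim e N C unfolding uniform_limit_iff by simp
      from e1 e2 show "\<forall>\<^sub>F n in sequentially. \<forall>x\<in>S. \<forall>h. norm ((\<Sum>l\<in>UNIV. h $ l *\<^sub>R D n l x)
          - (\<Sum>l\<in>UNIV. h $ l *\<^sub>R (A l x *v Yl x))) \<le> e * norm h"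
      proof eventually_elim
        fix n assume 1: "4 * C * norm y0 * (1/2)^n < e / (2 * N)"
          and 2: "\<forall>x\<in>S. dist (Y n x) (Yl x) < e / (2 * N * C)"
        show "\<forall>x\<in>S. \<forall>h. norm ((\<Sum>l\<in>UNIV. h $ l *\<^sub>R D n l x)
          - (\<Sum>l\<in>UNIV. h $ l *\<^sub>R (A l x *v Yl x))) \<le> e * norm h"
        proof (intro ballI allI)
          fix x and h :: "real^'n" assume x: "x \<in> S"
          have "norm (D n l x - A l x *v Yl x) \<le> e / N" for l
          proof -
            have DE: "D n l x - A l x *v Yl x = E n l x + A l x *v (Y n x - Yl x)"
              by (simp add: E_def matrix_vector_mult_diff_distrib)
            have E_le: "norm (E n l x) \<le> e / (2 * N)"
              using Ebound[OF x, of n l] 1 by linarith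
            have "norm (A l x *v (Y n x - Yl x)) \<le> C * (e / (2 * N * C))"
              using 2 x C(1) less_imp_le
              by (intro order_trans[OF bound[OF x] mult_left_mono]) (auto simp: dist_norm)
            also have "C * (e / (2 * N * C)) = e / (2 * N)" using C by simp
            finally have "norm (D n l x - A l x *v Yl x) \<le> e / (2 * N) + e / (2 * N)"
              unfolding DE using E_le by (intro order_trans[OF norm_triangle_ineq add_mono])
            then show ?thesis by (simp add: field_simps)
          qed
          then have "norm (\<Sum>l\<in>UNIV. h $ l *\<^sub>R (D n l x - A l x *v Yl x)) \<le> N * norm h * (e / N)"
            unfolding N_def by (rule norm_sum_component_le)
          then show "norm ((\<Sum>l\<in>UNIV. h $ l *\<^sub>R D n l x)
            - (\<Sum>l\<in>UNIV. h $ l *\<^sub>R (A l x *v Yl x))) \<le> e * norm h"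
            using N by (simp add: scaleR_diff_right sum_subtractf mult.commute)
        qed
      qed
    qed (rule S)
    then obtain g where g: "\<And>x. x \<in> S \<Longrightarrow> (\<lambda>n. Y n x) \<longlonglongrightarrow> g x"
        "\<And>x. x \<in> S \<Longrightarrow> (g has_derivative (\<lambda>v. \<Sum>l\<in>UNIV. v $ l *\<^sub>R (A l x *v Yl x))) (at x within S)"
      by blast
    have gY: "Yl x = g x" if "x \<in> S" for x
      using tendsto_uniform_limitI[OF lim that] g(1)[OF that] LIMSEQ_unique by blast
    have "has_grad g (\<lambda>s. A s x *v g x) x" if "x \<in> S" for x
      using g(2)[OF that] by (simp add: has_grad_def at_within_open[OF that S(1)] gY[OF that])
    moreover have "g x0 = y0"
      using g(1)[OF S(3)] by (simp add: Yx0 LIMSEQ_const_iff)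
    ultimately show ?thesis by blast
  qed
  show thesis
    using that[of r] r ex SU unfolding S_def by blast
qed

section \<open>The connection of the hyperboloid model\<close>

text \<open>Matrix of the \<open>dx\<^sub>s\<close>-component of a connection on the trivial bundle with fibre \<open>\<real>\<^sup>n \<oplus> \<real>\<close>.  The
index \<open>None\<close> stands for the time-like direction.  For \<open>v = V x\<close>, \<open>H = h x\<close> the parallel sections
\<open>(p, q)\<close> satisfy \<open>\<partial>\<^sub>s p\<^sub>m = - \<delta>\<^sub>m\<^sub>s (V\<^sub>s q + \<Sum>\<^sub>k p\<^sub>k h\<^sub>k\<^sub>s) + p\<^sub>s h\<^sub>m\<^sub>s\<close> and \<open>\<partial>\<^sub>s q = - V\<^sub>s p\<^sub>s\<close>.\<close>

definition conn_mat :: "'n \<Rightarrow> 'n::finite rvec \<Rightarrow> 'n rmat \<Rightarrow> real^('n option)^('n option)" where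
  "conn_mat s v H = (\<chi> a b. case a of
      None \<Rightarrow> (case b of None \<Rightarrow> 0 | Some k \<Rightarrow> if k = s then - v $ s else 0)
    | Some m \<Rightarrow> (case b of None \<Rightarrow> if m = s then - v $ s else 0
        | Some k \<Rightarrow> (if m = s then - H $ k $ s else 0) + (if k = s then H $ m $ s else 0)))"

lemma conn_mat_simps [simp]:
  "conn_mat s v H $ None $ None = 0"
  "conn_mat s v H $ None $ Some k = (if k = s then - v $ s else 0)"
  "conn_mat s v H $ Some m $ None = (if m = s then - v $ s else 0)"
  "conn_mat s v H $ Some m $ Some k = (if m = s then - H $ k $ s else 0) + (if k = s then H $ m $ s else 0)"
  by (simp_all add: conn_mat_def)

lemma option_mat_eqI:
  fixes M M' :: "real^('n::finite option)^('n option)"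
  assumes "M $ None $ None = M' $ None $ None" "\<And>k. M $ None $ Some k = M' $ None $ Some k"
    "\<And>m. M $ Some m $ None = M' $ Some m $ None" "\<And>m k. M $ Some m $ Some k = M' $ Some m $ Some k"
  shows "M = M'"
  unfolding vec_eq_iff using assms by (metis option.exhaust)

lemma sum_option: "(\<Sum>a\<in>(UNIV::'n::finite option set). f a) = f None + (\<Sum>k\<in>UNIV. f (Some k))"
  by (simp add: UNIV_option_conv sum.reindex)

lemma conn_mat_split: "conn_mat s v H = conn_mat s v 0 + conn_mat s 0 H"
  by (rule option_mat_eqI) auto

lemma bounded_linear_conn_mat:
  "bounded_linear (\<lambda>v. conn_mat s v 0)" "bounded_linear (\<lambda>H. conn_mat s 0 H)"
  by (auto intro!: linear_conv_bounded_linear[THEN iffD1] linearI option_mat_eqI simp: algebra_simps)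

lemma has_grad_conn_mat:
  assumes "has_grad v p x" "has_grad H P x"
  shows "has_grad (\<lambda>x. conn_mat s (v x) (H x)) (\<lambda>l. conn_mat s (p l) (P l)) x"
  using has_grad_add[OF has_grad_bounded_linear[OF bounded_linear_conn_mat(1)[of s] assms(1)]
      has_grad_bounded_linear[OF bounded_linear_conn_mat(2)[of s] assms(2)]]
  by (simp flip: conn_mat_split)

lemma continuous_on_conn_mat:
  assumes "continuous_on S v" "continuous_on S H"
  shows "continuous_on S (\<lambda>x. conn_mat s (v x) (H x))"
  using continuous_on_add[OF bounded_linear.continuous_on[OF bounded_linear_conn_mat(1)[of s] assms(1)]
      bounded_linear.continuous_on[OF bounded_linear_conn_mat(2)[of s] assms(2)]]
  by (simp flip: conn_mat_split)

lemma conn_mat_mult: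
  assumes "s \<noteq> l"
  shows "(conn_mat s v H ** conn_mat l v H) $ None $ None = 0"
    "(conn_mat s v H ** conn_mat l v H) $ None $ Some k = (if k = l then - (v $ s * H $ s $ l) else 0)"
    "(conn_mat s v H ** conn_mat l v H) $ Some m $ None = (if m = s then H $ l $ s * v $ l else 0)"
    "(conn_mat s v H ** conn_mat l v H) $ Some m $ Some k =
       (if m = s then H $ l $ s * H $ k $ l else 0) + (if k = l then H $ m $ s * H $ s $ l else 0)
       + (if m = s \<and> k = l then v $ s * v $ l - (\<Sum>r\<in>UNIV. H $ r $ s * H $ r $ l) else 0)"
proof -
  have ls: "l \<noteq> s" using assms by simp
  show "(conn_mat s v H ** conn_mat l v H) $ None $ None = 0"
    using assms by (simp add: matrix_matrix_mult_def sum_option if_distrib[of "\<lambda>z. z * _"] cong: if_cong)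
  show "(conn_mat s v H ** conn_mat l v H) $ None $ Some k = (if k = l then - (v $ s * H $ s $ l) else 0)"
    using assms by (simp add: matrix_matrix_mult_def sum_option if_distrib[of "\<lambda>z. z * _"] cong: if_cong)
  show "(conn_mat s v H ** conn_mat l v H) $ Some m $ None = (if m = s then H $ l $ s * v $ l else 0)"
    using assms ls by (simp add: matrix_matrix_mult_def sum_option if_distrib[of "\<lambda>z. _ * z"] cong: if_cong)
  have "(\<Sum>r\<in>UNIV. ((if m = s then - H $ r $ s else 0) + (if r = s then H $ m $ s else 0))
          * ((if r = l then - H $ k $ l else 0) + (if k = l then H $ r $ l else 0)))
      = (\<Sum>r\<in>UNIV. (if r = l then (if m = s then H $ l $ s * H $ k $ l else 0) else 0)
          + (if r = s then (if k = l then H $ m $ s * H $ s $ l else 0) else 0)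
          - (if m = s \<and> k = l then H $ r $ s * H $ r $ l else 0))"
    using assms by (intro sum.cong) auto
  also have "\<dots> = (if m = s then H $ l $ s * H $ k $ l else 0) + (if k = l then H $ m $ s * H $ s $ l else 0)
      - (if m = s \<and> k = l then (\<Sum>r\<in>UNIV. H $ r $ s * H $ r $ l) else 0)"
    by (cases "m = s \<and> k = l") (auto simp: sum.distrib sum_subtractf)
  finally show "(conn_mat s v H ** conn_mat l v H) $ Some m $ Some k =
       (if m = s then H $ l $ s * H $ k $ l else 0) + (if k = l then H $ m $ s * H $ s $ l else 0)
       + (if m = s \<and> k = l then v $ s * v $ l - (\<Sum>r\<in>UNIV. H $ r $ s * H $ r $ l) else 0)"
    by (simp add: matrix_matrix_mult_def sum_option)
qed

text \<open>The pointwise algebraic content of flatness: \<open>dv l\<close> and \<open>dH l\<close> play the role of the \<open>l\<close>-th partial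
derivatives of \<open>V\<close> and \<open>h\<close>, and the hypotheses are the equations of the IGSGE.\<close>

lemma conn_mat_flat:
  fixes v :: "'n::finite rvec" and H :: "'n rmat"
  assumes H0: "\<And>i. H $ i $ i = 0" and dH0: "\<And>l i. dH l $ i $ i = 0"
    and dv: "\<And>i j. i \<noteq> j \<Longrightarrow> dv j $ i = v $ j * H $ j $ i"
    and gauss: "\<And>i j. i \<noteq> j \<Longrightarrow> dH i $ i $ j + dH j $ j $ i + (\<Sum>s\<in>UNIV - {i, j}. H $ s $ i * H $ s $ j) = v $ i * v $ j"
    and dH: "\<And>i j s. i \<noteq> j \<Longrightarrow> j \<noteq> s \<Longrightarrow> i \<noteq> s \<Longrightarrow> dH s $ i $ j = H $ i $ s * H $ s $ j"
  shows "conn_mat s (dv l) (dH l) + conn_mat s v H ** conn_mat l v H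
       = conn_mat l (dv s) (dH s) + conn_mat l v H ** conn_mat s v H"
proof (cases "s = l")
  case False
  then have ls: "l \<noteq> s" by simp
  have gauss': "(\<Sum>r\<in>UNIV. H $ r $ i * H $ r $ j) = v $ i * v $ j - dH i $ i $ j - dH j $ j $ i"
    if "i \<noteq> j" for i j
  proof -
    have "(\<Sum>r\<in>UNIV. H $ r $ i * H $ r $ j) = (\<Sum>r\<in>UNIV - {i, j}. H $ r $ i * H $ r $ j)"
      by (rule sum.mono_neutral_right) (auto simp: H0)
    then show ?thesis using gauss[OF that] by simp
  qed
  show ?thesis
  proof (rule option_mat_eqI)
    show "(conn_mat s (dv l) (dH l) + conn_mat s v H ** conn_mat l v H) $ None $ None
       = (conn_mat l (dv s) (dH s) + conn_mat l v H ** conn_mat s v H) $ None $ None"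
      by (simp add: conn_mat_mult[OF False] conn_mat_mult[OF ls])
    show "(conn_mat s (dv l) (dH l) + conn_mat s v H ** conn_mat l v H) $ None $ Some k
       = (conn_mat l (dv s) (dH s) + conn_mat l v H ** conn_mat s v H) $ None $ Some k" for k
      using False by (simp add: conn_mat_mult[OF False] conn_mat_mult[OF ls] dv)
    show "(conn_mat s (dv l) (dH l) + conn_mat s v H ** conn_mat l v H) $ Some k $ None
       = (conn_mat l (dv s) (dH s) + conn_mat l v H ** conn_mat s v H) $ Some k $ None" for k
      using False by (simp add: conn_mat_mult[OF False] conn_mat_mult[OF ls] dv)
    show "(conn_mat s (dv l) (dH l) + conn_mat s v H ** conn_mat l v H) $ Some m $ Some k
       = (conn_mat l (dv s) (dH s) + conn_mat l v H ** conn_mat s v H) $ Some m $ Some k" for m k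
      using False
      by (cases "m = s"; cases "m = l"; cases "k = s"; cases "k = l")
        (simp_all add: conn_mat_mult[OF False] conn_mat_mult[OF ls] gauss'[OF False] gauss'[OF ls] H0 dH0 dH)
  qed
qed simp

lemma IGSGE_connection_flat:
  assumes U: "open U" and I: "IGSGE U V h" and x: "x \<in> U"
  shows "conn_mat s (partial l V x) (partial l h x) + conn_mat s (V x) (h x) ** conn_mat l (V x) (h x)
       = conn_mat l (partial s V x) (partial s h x) + conn_mat l (V x) (h x) ** conn_mat s (V x) (h x)"
proof (rule conn_mat_flat)
  have sm: "smooth_on U V" "smooth_on U h" using I by (auto simp: IGSGE_def)
  have gV: "has_grad V (\<lambda>l. partial l V x) x" and gh: "has_grad h (\<lambda>l. partial l h x) x"
    using differentiable_on_has_grad[OF U x] smooth_on_differentiable(1) sm by auto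
  have pV: "partial l V x $ i = partial l (\<lambda>y. V y $ i) x" for l i
    by (rule has_grad_partial[OF has_grad_nth[OF gV], symmetric])
  have ph: "partial l h x $ i $ j = partial l (\<lambda>y. h y $ i $ j) x" for l i j
    by (rule has_grad_partial[OF has_grad_nth[OF has_grad_nth[OF gh]], symmetric])
  show "h x $ i $ i = 0" for i using I x by (auto simp: IGSGE_def)
  show "partial l h x $ i $ i = 0" for l i
  proof -
    have "partial l (\<lambda>y. h y $ i $ i) x = partial l (\<lambda>_. 0::real) x"
      using I by (intro partial_cong_open[OF U x]) (auto simp: IGSGE_def)
    then show ?thesis by (simp add: ph has_grad_partial[OF has_grad_const])
  qed
  show "partial j V x $ i = V x $ j * h x $ j $ i" if "i \<noteq> j" for i j
    using I x that unfolding pV by (auto simp: IGSGE_def)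
  show "partial i h x $ i $ j + partial j h x $ j $ i + (\<Sum>s\<in>UNIV - {i, j}. h x $ s $ i * h x $ s $ j)
      = V x $ i * V x $ j" if "i \<noteq> j" for i j
    using I x that unfolding ph by (auto simp: IGSGE_def)
  show "partial s h x $ i $ j = h x $ i $ s * h x $ s $ j" if "i \<noteq> j" "j \<noteq> s" "i \<noteq> s" for i j s
    using I x that unfolding ph by (auto simp: IGSGE_def)
qed

section \<open>The equations for L as a moving frame\<close>

text \<open>The \<open>dx\<^sub>s\<close>-component of the row vector \<open>b W\<close>, where \<open>W\<^sub>k\<^sub>m = h\<^sub>k\<^sub>m dx\<^sub>m - h\<^sub>m\<^sub>k dx\<^sub>k\<close> and \<open>H\<close> is the value of \<open>h\<close>.\<close>

definition spin :: "'n \<Rightarrow> 'n::finite rmat \<Rightarrow> 'n rvec \<Rightarrow> 'n rvec" where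
  "spin s H b = (\<Sum>k\<in>UNIV. b $ k * H $ k $ s) *\<^sub>R axis s 1 - b $ s *\<^sub>R (\<chi> m. H $ m $ s)"

lemma spin_inner:
  "spin s H b \<bullet> c = (\<Sum>k\<in>UNIV. b $ k * H $ k $ s) * c $ s - b $ s * (\<Sum>k\<in>UNIV. c $ k * H $ k $ s)"
proof -
  have "(\<chi> m. H $ m $ s) \<bullet> c = (\<Sum>k\<in>UNIV. c $ k * H $ k $ s)"
    by (simp add: inner_vec_def mult.commute)
  then show ?thesis by (simp add: spin_def inner_diff_left inner_axis')
qed

lemma spin_skew: "spin s H b \<bullet> c = - (b \<bullet> spin s H c)"
  unfolding inner_commute[of b] by (simp add: spin_inner mult.commute)

lemma spin_self: "spin s H b \<bullet> b = 0"
  using spin_skew[of s H b b] by (simp add: inner_commute)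

lemma spin_linear: "spin s H (r *\<^sub>R b) = r *\<^sub>R spin s H b"
   "spin s H (b - c) = spin s H b - spin s H c"
  by (simp_all add: spin_def algebra_simps sum.distrib sum_subtractf sum_distrib_left)

text \<open>The \<open>s\<close>-th partial derivative of row \<open>i\<close> that the system for \<open>L\<close> prescribes at a point where
\<open>V\<close>, \<open>h\<close>, \<open>L\<close> take the values \<open>v\<close>, \<open>H\<close>, \<open>M\<close>.\<close>

definition frame_rhs :: "'n::{finite,linorder} \<Rightarrow> 'n rvec \<Rightarrow> 'n rmat \<Rightarrow> 'n rmat \<Rightarrow> 'n \<Rightarrow> 'n rvec" where
  "frame_rhs s v H M i = (v $ s * M $ i $ s) *\<^sub>R M $ first
     - (if i = first then v $ s *\<^sub>R axis s 1 else 0) - spin s H (M $ i)"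

text \<open>The system for \<open>L\<close>, including orthogonality, solved for the derivatives of the rows.\<close>

definition frame_system ::
  "('n::{finite,linorder} rvec) set \<Rightarrow> ('n rvec \<Rightarrow> 'n rvec) \<Rightarrow> ('n rvec \<Rightarrow> 'n rmat) \<Rightarrow> ('n rvec \<Rightarrow> 'n rmat) \<Rightarrow> bool" where
  "frame_system N V h L \<longleftrightarrow> (\<forall>x\<in>N. orthogonal_matrix (L x) \<and>
     (\<forall>i. has_grad (\<lambda>y. L y $ i) (\<lambda>s. frame_rhs s (V x) (h x) (L x) i) x))"

lemma orthogonal_matrix_rows: "orthogonal_matrix (M :: real^'n^'n) \<longleftrightarrow> (\<forall>i j. M $ i \<bullet> M $ j = (if i = j then 1 else 0))"
proof -
  have "orthogonal_matrix M \<longleftrightarrow> M ** transpose M = mat 1"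
    unfolding orthogonal_matrix_def using matrix_left_right_inverse by blast
  then show ?thesis
    by (simp add: matrix_matrix_mult_def transpose_def mat_def vec_eq_iff inner_vec_def)
qed

lemma orthonormal_rows_eqI:
  fixes M :: "real^'n^'n"
  assumes "orthogonal_matrix M" "\<And>j. y \<bullet> M $ j = z \<bullet> M $ j"
  shows "y = z"
proof -
  have "M *v y = M *v z"
    using assms(2) by (simp add: vec_eq_iff matrix_vector_mult_def inner_vec_def mult.commute)
  then have "transpose M *v (M *v y) = transpose M *v (M *v z)" by simp
  then show ?thesis using assms(1) by (simp add: matrix_vector_mul_assoc orthogonal_matrix_def)
qed

lemma frame_rhs_inner:
  assumes "orthogonal_matrix M"
  shows "frame_rhs s v H M i \<bullet> M $ j = (if j = first then v $ s * M $ i $ s else 0)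
     - (if i = first then v $ s * M $ j $ s else 0) - spin s H (M $ i) \<bullet> M $ j"
  using assms by (simp add: frame_rhs_def orthogonal_matrix_rows inner_diff_left inner_axis')

lemma dx_comb_eq_0: "(\<Sum>s\<in>UNIV. c s *\<^sub>R dx s) = 0 \<longleftrightarrow> (\<forall>s. c s = 0)"
proof -
  have "(\<Sum>s\<in>UNIV. c s *\<^sub>R dx s) $ {t} = c t" for t
  proof -
    have "(\<Sum>s\<in>UNIV. c s *\<^sub>R dx s) $ {t} = (\<Sum>s\<in>UNIV. if s = t then c s else 0)"
      unfolding sum_component by (rule sum.cong) (auto simp: dx_def axis_def)
    then show ?thesis by simp
  qed
  then show ?thesis by (metis (no_types, lifting) scaleR_zero_left sum.neutral zero_index)
qed

lemma LWLt_eq: "LWLt h L i j x = (\<Sum>s\<in>UNIV. (spin s (h x) (L x $ i) \<bullet> L x $ j) *\<^sub>R dx s)"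
proof -
  have "LWLt h L i j x = (\<Sum>k\<in>UNIV. \<Sum>l\<in>UNIV. (L x $ i $ k * L x $ j $ l * h x $ k $ l) *\<^sub>R dx l)
     - (\<Sum>k\<in>UNIV. \<Sum>l\<in>UNIV. (L x $ i $ k * L x $ j $ l * h x $ l $ k) *\<^sub>R dx k)"
    by (simp add: LWLt_def W_form_def transpose_def scaleR_diff_right sum_subtractf)
  also have "(\<Sum>k\<in>UNIV. \<Sum>l\<in>UNIV. (L x $ i $ k * L x $ j $ l * h x $ k $ l) *\<^sub>R dx l)
     = (\<Sum>l\<in>UNIV. ((\<Sum>k\<in>UNIV. L x $ i $ k * h x $ k $ l) * L x $ j $ l) *\<^sub>R dx l)"
    by (subst sum.swap) (simp add: sum_distrib_left sum_distrib_right scaleR_sum_left mult_ac)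
  also have "(\<Sum>k\<in>UNIV. \<Sum>l\<in>UNIV. (L x $ i $ k * L x $ j $ l * h x $ l $ k) *\<^sub>R dx k)
     = (\<Sum>k\<in>UNIV. (L x $ i $ k * (\<Sum>l\<in>UNIV. h x $ l $ k * L x $ j $ l)) *\<^sub>R dx k)"
    by (simp add: sum_distrib_left scaleR_sum_left mult_ac)
  finally show ?thesis
    by (simp add: spin_inner scaleR_diff_left sum_subtractf mult.commute)
qed

lemma dLLt_eq:
  assumes "has_grad (\<lambda>y. L y $ i) p x"
  shows "dLLt L i j x = (\<Sum>s\<in>UNIV. (p s \<bullet> L x $ j) *\<^sub>R dx s)"
proof -
  have "dLLt L i j x = (\<Sum>k\<in>UNIV. \<Sum>s\<in>UNIV. (L x $ j $ k * p s $ k) *\<^sub>R dx s)"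
    by (simp add: dLLt_def differential_def transpose_def has_grad_partial[OF has_grad_nth[OF assms]]
        scaleR_sum_right)
  also have "\<dots> = (\<Sum>s\<in>UNIV. (p s \<bullet> L x $ j) *\<^sub>R dx s)"
    by (subst sum.swap) (simp add: inner_vec_def scaleR_sum_left mult.commute)
  finally show ?thesis .
qed

text \<open>The one-forms of the system are the coefficients of \<open>dL\<^sub>i - frame_rhs\<close> with respect to the
basis of rows.  Those that the system leaves out, namely \<open>(i, 1)\<close> and \<open>(i, i)\<close>, are controlled by
skew symmetry of \<open>dL L\<^sup>t\<close>.\<close>

lemma L_system_iff_frame_system:
  assumes "open N"
  shows "L_system N V h L \<longleftrightarrow> frame_system N V h L"
proof
  assume "frame_system N V h L"
  then have orth: "orthogonal_matrix (L x)"
    and g: "has_grad (\<lambda>y. L y $ i) (\<lambda>s. frame_rhs s (V x) (h x) (L x) i) x" if "x \<in> N" for x i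
    using that by (auto simp: frame_system_def)
  have "L differentiable_on N"
    using has_grad_differentiable[OF has_grad_vec[OF g]] assms
    by (simp add: differentiable_on_eq_differentiable_at)
  then show "L_system N V h L"
    unfolding L_system_def
    by (auto simp: orth dLLt_eq[OF g] LWLt_eq theta_form_def frame_rhs_inner dx_comb_eq_0 mult.commute
        simp flip: sum.distrib scaleR_add_left)
next
  assume L: "L_system N V h L"
  have "orthogonal_matrix (L x) \<and> has_grad (\<lambda>y. L y $ i) (\<lambda>s. frame_rhs s (V x) (h x) (L x) i) x"
    if x: "x \<in> N" for x i
  proof
    have orth: "orthogonal_matrix (L y)" if "y \<in> N" for y using L that by (simp add: L_system_def)
    show "orthogonal_matrix (L x)" using orth[OF x] .
    define D where "D s i = partial s L x $ i" for s i
    have g: "has_grad (\<lambda>y. L y $ i) (\<lambda>s. D s i) x" for i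
      unfolding D_def using L x assms by (intro has_grad_nth differentiable_on_has_grad) (auto simp: L_system_def)
    \<comment> \<open>Differentiate the orthonormality relations of the rows.\<close>
    have skew: "D s i \<bullet> L x $ j = - (D s j \<bullet> L x $ i)" for s i j
    proof -
      have "has_grad (\<lambda>y. L y $ i \<bullet> L y $ j) (\<lambda>s. D s i \<bullet> L x $ j + L x $ i \<bullet> D s j) x"
        by (intro has_grad_bounded_bilinear[OF bounded_bilinear_inner] g)
      moreover have "has_grad (\<lambda>y. L y $ i \<bullet> L y $ j) (\<lambda>_. 0) x"
        by (rule has_grad_cong_open[OF has_grad_const[of "if i = j then 1 else 0"] assms x])
          (use orth in \<open>simp add: orthogonal_matrix_rows\<close>)
      ultimately have "D s i \<bullet> L x $ j + L x $ i \<bullet> D s j = 0"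
        by (metis (no_types, lifting) has_grad_partial)
      then show ?thesis by (simp add: inner_commute)
    qed
    have eq1: "D s first \<bullet> L x $ i = - spin s (h x) (L x $ first) \<bullet> L x $ i - V x $ s * L x $ i $ s"
      if "i \<noteq> first" for s i
    proof -
      have "dLLt L first i x + LWLt h L first i x + theta_form V L i x = 0"
        using L x that by (simp add: L_system_def)
      then have "\<forall>s. D s first \<bullet> L x $ i + spin s (h x) (L x $ first) \<bullet> L x $ i + L x $ i $ s * V x $ s = 0"
        by (simp add: dLLt_eq[OF g] LWLt_eq theta_form_def dx_comb_eq_0 flip: sum.distrib scaleR_add_left)
      then have "D s first \<bullet> L x $ i + spin s (h x) (L x $ first) \<bullet> L x $ i + L x $ i $ s * V x $ s = 0" by blast
      then show ?thesis by (simp add: algebra_simps)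
    qed
    have eq2: "D s i \<bullet> L x $ j = - spin s (h x) (L x $ i) \<bullet> L x $ j"
      if "i \<noteq> first" "j \<noteq> first" "i \<noteq> j" for s i j
    proof -
      have "dLLt L i j x + LWLt h L i j x = 0"
        using L x that by (simp add: L_system_def)
      then have "\<forall>s. D s i \<bullet> L x $ j + spin s (h x) (L x $ i) \<bullet> L x $ j = 0"
        by (simp add: dLLt_eq[OF g] LWLt_eq dx_comb_eq_0 flip: sum.distrib scaleR_add_left)
      then show ?thesis by (simp add: eq_neg_iff_add_eq_0)
    qed
    have "D s i = frame_rhs s (V x) (h x) (L x) i" for s
    proof (rule orthonormal_rows_eqI[OF orth[OF x]])
      fix j
      have "D s i \<bullet> L x $ i = 0" using skew[of s i i] by simp
      then show "D s i \<bullet> L x $ j = frame_rhs s (V x) (h x) (L x) i \<bullet> L x $ j"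
        unfolding frame_rhs_inner[OF orth[OF x]]
        using eq1[of i s] eq1[of j s] eq2[of i j s] skew[of s i j] spin_skew[of s "h x" "L x $ i" "L x $ j"]
        by (cases "i = j"; cases "i = first"; cases "j = first")
          (auto simp: spin_self inner_commute algebra_simps)
    qed
    then show "has_grad (\<lambda>y. L y $ i) (\<lambda>s. frame_rhs s (V x) (h x) (L x) i) x"
      using g[of i] by simp
  qed
  then show "frame_system N V h L" by (simp add: frame_system_def)
qed

section \<open>Uniqueness\<close>

text \<open>A Gronwall argument: along the segment, \<open>exp (-2Ct) u\<^sup>2\<close> does not increase.\<close>

lemma vanishing_spreads_along_segment:
  fixes u :: "'n::finite rvec \<Rightarrow> real"
  assumes S: "convex S" "x \<in> S" "y \<in> S"
    and grad: "\<And>z. z \<in> S \<Longrightarrow> has_grad u (\<lambda>s. g s z * u z) z"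
    and bound: "\<And>s z. z \<in> S \<Longrightarrow> \<bar>g s z\<bar> \<le> K"
    and ux: "u x = 0"
  shows "u y = 0"
proof -
  define \<gamma> where "\<gamma> t = x + t *\<^sub>R (y - x)" for t :: real
  define C where "C = real CARD('n) * norm (y - x) * K"
  define c where "c t = (\<Sum>s\<in>UNIV. (y - x) $ s * g s (\<gamma> t))" for t
  define \<psi> where "\<psi> t = exp (- (2 * C * t)) * (u (\<gamma> t))\<^sup>2" for t
  have "\<psi> 1 \<le> \<psi> 0"
  proof (rule DERIV_nonpos_imp_nonincreasing[of 0 1 \<psi>])
    fix t :: real assume t: "0 \<le> t" "t \<le> 1"
    have \<gamma>: "\<gamma> t \<in> S" unfolding \<gamma>_def using segment_in_convex[OF S] t by simp
    have "((\<lambda>t. u (\<gamma> t)) has_vector_derivative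
        (\<Sum>s\<in>UNIV. (y - x) $ s *\<^sub>R (g s (\<gamma> t) * u (\<gamma> t)))) (at t)"
      using has_vector_derivative_radial[OF grad[OF \<gamma>, unfolded \<gamma>_def]] by (simp add: \<gamma>_def)
    moreover have "(\<Sum>s\<in>UNIV. (y - x) $ s *\<^sub>R (g s (\<gamma> t) * u (\<gamma> t))) = c t * u (\<gamma> t)"
      by (simp add: c_def sum_distrib_right mult.assoc)
    ultimately have "((\<lambda>t. u (\<gamma> t)) has_real_derivative c t * u (\<gamma> t)) (at t)"
      by (simp add: has_real_derivative_iff_has_vector_derivative)
    then have "(\<psi> has_real_derivative 2 * exp (- (2 * C * t)) * (u (\<gamma> t))\<^sup>2 * (c t - C)) (at t)"
      unfolding \<psi>_def by (auto intro!: derivative_eq_intros simp: power2_eq_square algebra_simps)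
    moreover have "\<bar>c t\<bar> \<le> C"
      using norm_sum_component_le[of "\<lambda>s. g s (\<gamma> t)" K "y - x"] bound[OF \<gamma>] by (simp add: c_def C_def)
    ultimately show "\<exists>d. DERIV \<psi> t :> d \<and> d \<le> 0"
      by (intro exI conjI) (auto intro!: mult_nonneg_nonpos)
  qed simp
  then show ?thesis using ux by (simp add: \<psi>_def \<gamma>_def mult_le_0_iff)
qed

lemma homogeneous_gradient_vanishes:
  fixes u :: "'n::finite rvec \<Rightarrow> real"
  assumes M: "open M" "connected M" "x0 \<in> M" "x \<in> M"
    and grad: "\<And>z. z \<in> M \<Longrightarrow> has_grad u (\<lambda>s. g s z * u z) z"
    and bound: "\<And>s z. z \<in> M \<Longrightarrow> \<bar>g s z\<bar> \<le> K"
    and "u x0 = 0"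
  shows "u x = 0"
proof (rule connected_induction_simple[OF M(2), of x0 x "\<lambda>z. u z = 0"])
  fix a assume "a \<in> M"
  then obtain e where e: "e > 0" "ball a e \<subseteq> M" using M(1) open_contains_ball by blast
  have "\<forall>y\<in>ball a e. \<forall>z\<in>ball a e. u y = 0 \<longrightarrow> u z = 0"
    using e(2) vanishing_spreads_along_segment[OF convex_ball, of _ a e _ u g K] grad bound by blast
  then show "\<exists>T. openin (top_of_set M) T \<and> a \<in> T \<and> (\<forall>y\<in>T. \<forall>z\<in>T. u y = 0 \<longrightarrow> u z = 0)"
    using e M(1) by (intro exI[of _ "ball a e"]) (auto simp: open_openin_trans)
qed (use M assms(7) in auto)

lemma unit_inner_eq_1:
  fixes a b :: "'a::real_inner"
  assumes "a \<bullet> a = 1" "b \<bullet> b = 1" "a \<bullet> b = 1"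
  shows "a = b"
proof -
  have "(a - b) \<bullet> (a - b) = 0" using assms by (simp add: inner_diff_left inner_diff_right inner_commute)
  then show ?thesis by simp
qed

text \<open>The condition \<open>V \<bullet> V = 1\<close> only serves to bound the coefficients of the equation for
\<open>1 - L\<^sub>1 \<bullet> L'\<^sub>1\<close>.\<close>

lemma frame_system_unique:
  fixes V :: "'n::{finite,linorder} rvec \<Rightarrow> 'n rvec"
  assumes M: "open M" "connected M" "x0 \<in> M"
    and V: "\<And>x. x \<in> M \<Longrightarrow> V x \<bullet> V x = 1"
    and L: "frame_system M V h L" and L': "frame_system M V h L'" and eq: "L x0 = L' x0" and x: "x \<in> M"
  shows "L x = L' x"
proof -
  have orth: "orthogonal_matrix (L x)" "orthogonal_matrix (L' x)"
    and g: "has_grad (\<lambda>y. L y $ i) (\<lambda>s. frame_rhs s (V x) (h x) (L x) i) x"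
      "has_grad (\<lambda>y. L' y $ i) (\<lambda>s. frame_rhs s (V x) (h x) (L' x) i) x" if "x \<in> M" for x i
    using that L L' by (auto simp: frame_system_def)
  note rows = orth[unfolded orthogonal_matrix_rows, rule_format]
  have inner: "has_grad (\<lambda>y. 1 - L y $ i \<bullet> L' y $ i) (\<lambda>s. - (frame_rhs s (V x) (h x) (L x) i \<bullet> L' x $ i
      + L x $ i \<bullet> frame_rhs s (V x) (h x) (L' x) i)) x" if "x \<in> M" for x i
    using has_grad_diff[OF has_grad_const[of 1]
        has_grad_bounded_bilinear[OF bounded_bilinear_inner g[OF that, of i]]] by simp
  have unit: "\<bar>a $ s\<bar> \<le> 1" if "a \<bullet> a = 1" for a :: "'n rvec" and s
    using component_le_norm_cart[of a s] that by (simp add: norm_eq_sqrt_inner)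
  have first: "L x $ first = L' x $ first" if "x \<in> M" for x
  proof -
    define u where "u y = 1 - L y $ first \<bullet> L' y $ first" for y
    have "u x = 0"
    proof (rule homogeneous_gradient_vanishes[OF M that])
      fix z assume z: "z \<in> M"
      have "- (frame_rhs s (V z) (h z) (L z) first \<bullet> L' z $ first + L z $ first \<bullet> frame_rhs s (V z) (h z) (L' z) first)
        = (V z $ s * (L z $ first $ s + L' z $ first $ s)) * u z" for s
        using spin_skew[of s "h z" "L z $ first" "L' z $ first"]
        by (simp add: frame_rhs_def u_def inner_diff_left inner_diff_right inner_axis inner_axis' algebra_simps)
      then show "has_grad u (\<lambda>s. (V z $ s * (L z $ first $ s + L' z $ first $ s)) * u z) z"
        using inner[OF z, of first] by (simp add: u_def[abs_def])
      fix s
      have "\<bar>V z $ s\<bar> * \<bar>L z $ first $ s + L' z $ first $ s\<bar> \<le> 1 * (1 + 1)"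
        using unit[OF V[OF z]] unit[of "L z $ first" s] unit[of "L' z $ first" s] rows[OF z]
        by (intro mult_mono order_trans[OF abs_triangle_ineq] add_mono) auto
      then show "\<bar>V z $ s * (L z $ first $ s + L' z $ first $ s)\<bar> \<le> 2" by (simp add: abs_mult)
    next
      show "u x0 = 0" unfolding u_def eq by (simp add: rows(2)[OF M(3)])
    qed
    then show ?thesis
      using rows(1)[OF that, of first first] rows(2)[OF that, of first first]
      by - (rule unit_inner_eq_1, simp_all add: u_def)
  qed
  have "L x $ i = L' x $ i" for i
  proof (cases "i = first")
    case False
    \<comment> \<open>The spin terms cancel by skewness, the others because both rows are orthogonal to
      the common first row.\<close>
    define u where "u y = 1 - L y $ i \<bullet> L' y $ i" for y
    have "u x = 0"
    proof (rule homogeneous_gradient_vanishes[OF M x])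
      fix z assume z: "z \<in> M"
      have "- (frame_rhs s (V z) (h z) (L z) i \<bullet> L' z $ i + L z $ i \<bullet> frame_rhs s (V z) (h z) (L' z) i) = 0" for s
        using spin_skew[of s "h z" "L z $ i" "L' z $ i"] rows(1)[OF z, of i first] rows(2)[OF z, of first i] first[OF z] False
        by (simp add: frame_rhs_def inner_diff_left inner_diff_right)
      then show "has_grad u (\<lambda>s. 0 * u z) z"
        using inner[OF z, of i] by (simp add: u_def[abs_def])
      show "\<bar>0\<bar> \<le> (0::real)" by simp
    next
      show "u x0 = 0" unfolding u_def eq by (simp add: rows(2)[OF M(3)])
    qed
    then show ?thesis
      using rows(1)[OF x, of i i] rows(2)[OF x, of i i]
      by - (rule unit_inner_eq_1, simp_all add: u_def)
  qed (use first[OF x] in simp)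
  then show ?thesis by (simp add: vec_eq_iff)
qed

section \<open>Existence and smoothness\<close>

text \<open>The \<open>\<real>\<^sup>n\<close> component of a vector of the fibre \<open>\<real>\<^sup>n \<oplus> \<real>\<close>.\<close>

definition space_part :: "real^('n::finite option) \<Rightarrow> 'n rvec" where
  "space_part y = (\<chi> m. y $ Some m)"

lemma bounded_linear_space_part: "bounded_linear space_part"
  by (auto intro!: linear_conv_bounded_linear[THEN iffD1] linearI simp: space_part_def vec_eq_iff)

lemma conn_mat_vec:
  "(conn_mat s v H *v y) $ None = - (v $ s * space_part y $ s)"
  "space_part (conn_mat s v H *v y) = - (y $ None * v $ s) *\<^sub>R axis s 1 - spin s H (space_part y)"
proof -
  show "(conn_mat s v H *v y) $ None = - (v $ s * space_part y $ s)"
    by (simp add: matrix_vector_mult_def sum_option space_part_def if_distrib[of "\<lambda>z. z * _"] cong: if_cong)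
  have "(\<Sum>k\<in>UNIV. ((if m = s then - H $ k $ s else 0) + (if k = s then H $ m $ s else 0)) * y $ Some k)
     = (if m = s then - (\<Sum>k\<in>UNIV. y $ Some k * H $ k $ s) else 0) + y $ Some s * H $ m $ s" for m
  proof -
    have "(\<Sum>k\<in>UNIV. ((if m = s then - H $ k $ s else 0) + (if k = s then H $ m $ s else 0)) * y $ Some k)
      = (\<Sum>k\<in>UNIV. (if m = s then - (y $ Some k * H $ k $ s) else 0) + (if k = s then y $ Some s * H $ m $ s else 0))"
      by (intro sum.cong) (auto simp: algebra_simps)
    then show ?thesis by (simp add: sum.distrib sum_negf)
  qed
  then show "space_part (conn_mat s v H *v y) = - (y $ None * v $ s) *\<^sub>R axis s 1 - spin s H (space_part y)"
    by (simp add: vec_eq_iff matrix_vector_mult_def sum_option space_part_def spin_def axis_def)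
qed

text \<open>The Minkowski product of signature \<open>(n, 1)\<close>, which parallel transport preserves.\<close>

definition minkowski :: "real^('n::finite option) \<Rightarrow> real^('n option) \<Rightarrow> real" where
  "minkowski y z = space_part y \<bullet> space_part z - y $ None * z $ None"

lemma has_grad_minkowski:
  assumes "has_grad Y (\<lambda>s. conn_mat s v H *v Y x) x" "has_grad Z (\<lambda>s. conn_mat s v H *v Z x) x"
  shows "has_grad (\<lambda>x. minkowski (Y x) (Z x)) (\<lambda>_. 0) x"
proof -
  note sp = has_grad_bounded_linear[OF bounded_linear_space_part]
  have "has_grad (\<lambda>x. minkowski (Y x) (Z x)) (\<lambda>s.
     (space_part (conn_mat s v H *v Y x) \<bullet> space_part (Z x) + space_part (Y x) \<bullet> space_part (conn_mat s v H *v Z x))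
     - ((conn_mat s v H *v Y x) $ None * Z x $ None + Y x $ None * (conn_mat s v H *v Z x) $ None)) x"
    unfolding minkowski_def
    by (intro has_grad_diff has_grad_bounded_bilinear[OF bounded_bilinear_inner]
      has_grad_bounded_bilinear[OF bounded_bilinear_mult] sp has_grad_nth assms)
  moreover have "(space_part (conn_mat s v H *v y) \<bullet> space_part z + space_part y \<bullet> space_part (conn_mat s v H *v z))
     - ((conn_mat s v H *v y) $ None * z $ None + y $ None * (conn_mat s v H *v z) $ None) = 0" for s y z
    using spin_skew[of s H "space_part y" "space_part z"]
    by (simp add: conn_mat_vec inner_diff_left inner_diff_right inner_axis inner_axis' algebra_simps)
  ultimately show ?thesis by simp
qed

lemma frame_system_exists:
  fixes V :: "'n::{finite,linorder} rvec \<Rightarrow> 'n rvec"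
  assumes U: "open U" "x0 \<in> U" and I: "IGSGE U V h" and L0: "orthogonal_matrix L0"
  obtains \<rho> L where "0 < \<rho>" "ball x0 \<rho> \<subseteq> U" "frame_system (ball x0 \<rho>) V h L" "L x0 = L0"
proof -
  have sm: "smooth_on U V" "smooth_on U h" using I by (auto simp: IGSGE_def)
  obtain r where r: "0 < r" "ball x0 r \<subseteq> U"
    and ex: "\<And>y0. \<exists>Y. Y x0 = y0 \<and> (\<forall>x\<in>ball x0 r. has_grad Y (\<lambda>s. conn_mat s (V x) (h x) *v Y x) x)"
  proof (rule flat_linear_system_solvable[OF U, where A = "\<lambda>s x. conn_mat s (V x) (h x)"
      and dA = "\<lambda>l s x. conn_mat s (partial l V x) (partial l h x)"])
    fix s l :: 'n
    show "has_grad (\<lambda>x. conn_mat s (V x) (h x)) (\<lambda>l. conn_mat s (partial l V x) (partial l h x)) x" if "x \<in> U" for x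
      by (intro has_grad_conn_mat differentiable_on_has_grad[OF U(1) that] smooth_on_differentiable sm)
    show "continuous_on U (\<lambda>x. conn_mat s (partial l V x) (partial l h x))"
      by (intro continuous_on_conn_mat differentiable_imp_continuous_on smooth_on_differentiable sm)
  qed (use IGSGE_connection_flat[OF U(1) I] in auto)
  \<comment> \<open>The time-like component is 1 for the first row only, so that \<open>L x0 = L0\<close> below.\<close>
  define y0 where "y0 i = (\<chi> a. case a of None \<Rightarrow> (if i = first then 1 else 0) | Some k \<Rightarrow> L0 $ i $ k)" for i
  have "\<forall>i. \<exists>Y. Y x0 = y0 i \<and> (\<forall>x\<in>ball x0 r. has_grad Y (\<lambda>s. conn_mat s (V x) (h x) *v Y x) x)"
    using ex by blast
  from choice[OF this] obtain Y where Y0: "\<And>i. Y i x0 = y0 i"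
    and Y: "\<And>i x. x \<in> ball x0 r \<Longrightarrow> has_grad (Y i) (\<lambda>s. conn_mat s (V x) (h x) *v Y i x) x"
    by blast
  have mink: "minkowski (Y i x) (Y j x) = (if i = j then 1 else 0) - (if i = first \<and> j = first then 1 else 0)"
    if x: "x \<in> ball x0 r" for i j x
  proof -
    have "minkowski (Y i x) (Y j x) = minkowski (Y i x0) (Y j x0)"
    proof (rule has_derivative_zero_unique_connected[OF open_ball connected_ball _ x])
      show "((\<lambda>x. minkowski (Y i x) (Y j x)) has_derivative (\<lambda>_. 0)) (at z)" if "z \<in> ball x0 r" for z
        using has_grad_minkowski[OF Y Y, OF that that] by (simp add: has_grad_def)
    qed (use r in simp)
    also have "\<dots> = L0 $ i \<bullet> L0 $ j - (if i = first \<and> j = first then 1 else 0)"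
      by (simp add: minkowski_def Y0 y0_def space_part_def inner_vec_def)
    finally show ?thesis using L0 by (simp add: orthogonal_matrix_rows)
  qed
  define q where "q x = Y first x $ None" for x
  \<comment> \<open>Shrink the ball so that \<open>q\<close>, which is 1 at the centre, stays positive.\<close>
  have "continuous_on (ball x0 r) q"
    unfolding q_def by (rule has_grad_continuous_on[OF has_grad_nth[OF Y]])
  then have "open (ball x0 r \<inter> q -` {0<..})"
    by (intro continuous_open_preimage) auto
  moreover have "x0 \<in> ball x0 r \<inter> q -` {0<..}" using r by (simp add: q_def Y0 y0_def)
  ultimately obtain \<rho> where \<rho>: "0 < \<rho>" "ball x0 \<rho> \<subseteq> ball x0 r \<inter> q -` {0<..}"
    using open_contains_ball by blast
  define a where "a x = inverse (q x) *\<^sub>R space_part (Y first x)" for x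
  define L where "L x = (\<chi> i. if i = first then a x else space_part (Y i x) - Y i x $ None *\<^sub>R a x)" for x
  have "frame_system (ball x0 \<rho>) V h L"
    unfolding frame_system_def
  proof (intro ballI conjI allI)
    fix x assume "x \<in> ball x0 \<rho>"
    then have x: "x \<in> ball x0 r" and q: "q x > 0" using \<rho> by auto
    have pp: "space_part (Y i x) \<bullet> space_part (Y j x) = Y i x $ None * Y j x $ None
        + (if i = j then 1 else 0) - (if i = first \<and> j = first then 1 else 0)" for i j
      using mink[OF x, of i j] by (simp add: minkowski_def)
    have aa: "a x \<bullet> a x = 1" using q by (simp add: a_def pp q_def[symmetric] field_simps)
    have pa: "space_part (Y i x) \<bullet> a x = Y i x $ None" if "i \<noteq> first" for i
      using q that by (simp add: a_def pp q_def[symmetric] field_simps)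
    have ap: "a x \<bullet> space_part (Y i x) = Y i x $ None" if "i \<noteq> first" for i
      using pa[OF that] by (simp add: inner_commute)
    show "orthogonal_matrix (L x)"
      by (auto simp: orthogonal_matrix_rows L_def inner_diff_left inner_diff_right aa pa ap pp)
    have ga: "has_grad a (\<lambda>s. (V x $ s * a x $ s) *\<^sub>R a x - V x $ s *\<^sub>R axis s 1 - spin s (h x) (a x)) x"
    proof -
      have "has_grad a (\<lambda>s. (- (inverse (q x) * inverse (q x)) * (conn_mat s (V x) (h x) *v Y first x) $ None) *\<^sub>R space_part (Y first x)
          + inverse (q x) *\<^sub>R space_part (conn_mat s (V x) (h x) *v Y first x)) x"
        unfolding a_def[abs_def] q_def
        using q unfolding q_def
        by (intro has_grad_bounded_bilinear[OF bounded_bilinear_scaleR] has_grad_inverse has_grad_nth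
            has_grad_bounded_linear[OF bounded_linear_space_part] Y[OF x]) auto
      moreover have "(- (inverse (q x) * inverse (q x)) * (conn_mat s (V x) (h x) *v Y first x) $ None) *\<^sub>R space_part (Y first x)
          + inverse (q x) *\<^sub>R space_part (conn_mat s (V x) (h x) *v Y first x)
          = (V x $ s * a x $ s) *\<^sub>R a x - V x $ s *\<^sub>R axis s 1 - spin s (h x) (a x)" for s
        using q by (simp add: conn_mat_vec a_def spin_linear q_def[symmetric] scaleR_diff_right mult_ac)
      ultimately show ?thesis by simp
    qed
    fix i
    show "has_grad (\<lambda>y. L y $ i) (\<lambda>s. frame_rhs s (V x) (h x) (L x) i) x"
    proof (cases "i = first")
      case True
      then show ?thesis using ga by (simp add: L_def frame_rhs_def)
    next
      case False
      have "has_grad (\<lambda>x. space_part (Y i x) - Y i x $ None *\<^sub>R a x) (\<lambda>s. space_part (conn_mat s (V x) (h x) *v Y i x)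
         - ((conn_mat s (V x) (h x) *v Y i x) $ None *\<^sub>R a x + Y i x $ None *\<^sub>R
            ((V x $ s * a x $ s) *\<^sub>R a x - V x $ s *\<^sub>R axis s 1 - spin s (h x) (a x)))) x"
        by (intro has_grad_diff has_grad_bounded_bilinear[OF bounded_bilinear_scaleR] has_grad_nth ga
            has_grad_bounded_linear[OF bounded_linear_space_part] Y[OF x])
      moreover have "space_part (conn_mat s (V x) (h x) *v Y i x)
         - ((conn_mat s (V x) (h x) *v Y i x) $ None *\<^sub>R a x + Y i x $ None *\<^sub>R
            ((V x $ s * a x $ s) *\<^sub>R a x - V x $ s *\<^sub>R axis s 1 - spin s (h x) (a x)))
         = frame_rhs s (V x) (h x) (L x) i" for s
        using False by (simp add: conn_mat_vec L_def frame_rhs_def spin_linear algebra_simps)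
      ultimately show ?thesis using False by (simp add: L_def)
    qed
  qed
  moreover have "L x0 = L0"
    by (simp add: L_def a_def q_def Y0 y0_def space_part_def vec_eq_iff)
  ultimately show thesis using that[of \<rho> L] \<rho> r by blast
qed

lemma IGSGE_smooth_subset:
  assumes "IGSGE U V h" "N \<subseteq> U"
  shows "smooth_on N V" "smooth_on N h"
proof -
  have "smooth_on U V" "smooth_on U h" using assms(1) by (simp_all add: IGSGE_def)
  then show "smooth_on N V" "smooth_on N h" using assms(2) by (simp_all add: smooth_on_subset)
qed

lemma frame_system_smooth:
  assumes N: "open N" and V: "smooth_on N V" and h: "smooth_on N h" and L: "frame_system N V h L"
  shows "smooth_on N L"
proof -
  have g: "has_grad L (\<lambda>s. \<chi> i. frame_rhs s (V x) (h x) (L x) i) x" if "x \<in> N" for x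
    using L that by (intro has_grad_vec) (simp add: frame_system_def)
  have "diff_order m N L" for m
  proof (induction m)
    case 0
    show ?case
      using g N by (auto simp: diff_order_0 differentiable_on_eq_differentiable_at intro: has_grad_differentiable)
  next
    case (Suc m)
    have V': "diff_order m N V" and h': "diff_order m N h" using V h by (auto simp: smooth_on_iff)
    show ?case
    proof (rule diff_order_SucI[OF N g])
      fix s
      have "diff_order m N (\<lambda>x. if i = first then V x $ s *\<^sub>R axis s (1::real) else 0)" for i :: 'a
        using N V' by (cases "i = first") (auto intro!: diff_order_scaleR diff_order_const diff_order_nth)
      then show "diff_order m N (\<lambda>x. \<chi> i. frame_rhs s (V x) (h x) (L x) i)"
        unfolding frame_rhs_def spin_def
        by (intro diff_order_vec diff_order_diff diff_order_scaleR diff_order_mult diff_order_sum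
            diff_order_nth diff_order_const N V' h' Suc finite)
    qed
  qed
  then show ?thesis by (simp add: smooth_on_iff)
qed

section \<open>Closedness of the conservation laws\<close>

lemma shuffle_sign_singleton:
  "shuffle_sign {k} K = (- 1) ^ card {m \<in> K. m < k}"
proof -
  have "{(i, j). i \<in> {k} \<and> j \<in> K \<and> j < i} = Pair k ` {m \<in> K. m < k}" by auto
  then show ?thesis by (simp add: shuffle_sign_def card_image inj_on_def)
qed

lemma shuffle_sign_insert:
  fixes K :: "'n::{finite,linorder} set"
  assumes "j \<notin> K"
  shows "shuffle_sign {k} (insert j K) = (if j < k then - 1 else 1) * shuffle_sign {k} K"
proof -
  have "{m \<in> insert j K. m < k} = (if j < k then insert j {m \<in> K. m < k} else {m \<in> K. m < k})"
    by auto
  then show ?thesis using assms by (simp add: shuffle_sign_singleton)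
qed

lemma bounded_bilinear_wedge: "bounded_bilinear (wedge :: 'n::{finite,linorder} ext \<Rightarrow> _)"
  by (auto intro!: bilinear_conv_bounded_bilinear[THEN iffD1] linearI
      simp: bilinear_def wedge_def vec_eq_iff algebra_simps sum.distrib sum_distrib_left)

lemma dx_wedge_axis:
  fixes K :: "'n::{finite,linorder} set"
  shows "dx k \<and>\<^sub>w axis K 1 = (if k \<in> K then 0 else shuffle_sign {k} K *\<^sub>R axis (insert k K) 1)"
proof (rule vec_eq_iff[THEN iffD2], rule allI)
  fix M :: "'n set"
  have "(dx k \<and>\<^sub>w axis K 1) $ M = (\<Sum>I\<in>Pow M. if I = {k} then shuffle_sign I (M - I) * axis K 1 $ (M - I) else 0)"
    unfolding wedge_def vec_lambda_beta dx_def by (rule sum.cong) (auto simp: axis_def)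
  also have "\<dots> = (if k \<in> M then shuffle_sign {k} (M - {k}) * axis K 1 $ (M - {k}) else 0)"
    by (subst sum.delta) auto
  also have "\<dots> = (if k \<in> K then 0 else shuffle_sign {k} K *\<^sub>R axis (insert k K) 1) $ M"
    by (auto simp: axis_def insert_absorb)
  finally show "(dx k \<and>\<^sub>w axis K 1) $ M = (if k \<in> K then 0 else shuffle_sign {k} K *\<^sub>R axis (insert k K) 1) $ M" .
qed

lemma wedge_dx_eq_axis:
  fixes K :: "'n::{finite,linorder} set"
  shows "wedge_dx K = axis K 1"
proof -
  have "foldr (\<lambda>k a. dx k \<and>\<^sub>w a) xs (axis {} 1) = axis (set xs) 1" if "sorted_wrt (<) xs" for xs :: "'n list"
    using that
  proof (induction xs)
    case (Cons k xs)
    then have "{m \<in> set xs. m < k} = {}" and k: "k \<notin> set xs" by auto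
    then have "shuffle_sign {k} (set xs) = 1" by (simp only: shuffle_sign_singleton card.empty power_0)
    with k show ?case using Cons by (simp add: dx_wedge_axis)
  qed simp
  from this[of "sorted_list_of_set K"] show ?thesis
    by (simp add: wedge_dx_def strict_sorted_list_of_set)
qed

text \<open>Only the \<open>dx\<^sub>\<tau>\<close> and \<open>dx\<^sub>j\<close> components of \<open>\<theta>\<close> survive in \<open>\<psi>\<^sub>j\<close>; they contribute to the coefficients that
omit \<open>dx\<^sub>j\<close> and \<open>dx\<^sub>\<tau>\<close>, respectively.\<close>

lemma psi_form_eq:
  fixes V :: "'n::{finite,linorder} rvec \<Rightarrow> 'n rvec"
  assumes "j \<noteq> \<tau>"
  defines "K \<equiv> UNIV - {\<tau>, j}"
  shows "psi_form V L \<tau> j x = (L x $ first $ \<tau> * V x $ \<tau>) *\<^sub>R (shuffle_sign {\<tau>} K *\<^sub>R axis (UNIV - {j}) 1)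
     + (L x $ first $ j * V x $ j) *\<^sub>R (shuffle_sign {j} K *\<^sub>R axis (UNIV - {\<tau>}) 1)"
proof -
  interpret wedge: bounded_bilinear "wedge :: 'n ext \<Rightarrow> _" by (rule bounded_bilinear_wedge)
  have "psi_form V L \<tau> j x = (\<Sum>k\<in>UNIV. (L x $ first $ k * V x $ k) *\<^sub>R (dx k \<and>\<^sub>w axis K 1))"
    by (simp add: psi_form_def theta_form_def wedge_dx_eq_axis K_def wedge.sum_left wedge.scaleR_left)
  also have "\<dots> = (\<Sum>k\<in>{\<tau>, j}. (L x $ first $ k * V x $ k) *\<^sub>R (dx k \<and>\<^sub>w axis K 1))"
    by (rule sum.mono_neutral_right) (auto simp: K_def dx_wedge_axis)
  also have "insert \<tau> K = UNIV - {j}" "insert j K = UNIV - {\<tau>}" using assms(1) by (auto simp: K_def)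
  then have "(\<Sum>k\<in>{\<tau>, j}. (L x $ first $ k * V x $ k) *\<^sub>R (dx k \<and>\<^sub>w axis K 1))
    = (L x $ first $ \<tau> * V x $ \<tau>) *\<^sub>R (shuffle_sign {\<tau>} K *\<^sub>R axis (UNIV - {j}) 1)
     + (L x $ first $ j * V x $ j) *\<^sub>R (shuffle_sign {j} K *\<^sub>R axis (UNIV - {\<tau>}) 1)"
    using assms(1) by (simp add: dx_wedge_axis) (simp add: K_def)
  finally show ?thesis .
qed

text \<open>Moving \<open>dx\<^sub>\<tau>\<close> and then \<open>dx\<^sub>j\<close> into place, or the other way round, differs by one transposition.\<close>

lemma shuffle_sign_swap:
  fixes \<tau> j :: "'n::{finite,linorder}"
  assumes "j \<noteq> \<tau>"
  shows "shuffle_sign {\<tau>} (UNIV - {\<tau>, j}) * shuffle_sign {j} (UNIV - {j})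
    = - (shuffle_sign {j} (UNIV - {\<tau>, j}) * shuffle_sign {\<tau>} (UNIV - {\<tau>}))"
proof -
  have e: "UNIV - {j} = insert \<tau> (UNIV - {\<tau>, j})" "UNIV - {\<tau>} = insert j (UNIV - {\<tau>, j})"
    using assms by auto
  show ?thesis
    unfolding e using assms by (subst (1 2) shuffle_sign_insert) auto
qed

lemma ext_deriv_psi_form:
  fixes V :: "'n::{finite,linorder} rvec \<Rightarrow> 'n rvec"
  assumes "j \<noteq> \<tau>"
    and "has_grad (\<lambda>y. L y $ first $ \<tau> * V y $ \<tau>) p x" "has_grad (\<lambda>y. L y $ first $ j * V y $ j) q x"
  shows "ext_deriv (psi_form V L \<tau> j) x =
    (shuffle_sign {j} (UNIV - {\<tau>, j}) * shuffle_sign {\<tau>} (UNIV - {\<tau>}) * (q \<tau> - p j)) *\<^sub>R axis UNIV 1"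
proof -
  interpret wedge: bounded_bilinear "wedge :: 'n ext \<Rightarrow> _" by (rule bounded_bilinear_wedge)
  let ?K = "UNIV - {\<tau>, j}"
  have "has_grad (psi_form V L \<tau> j) (\<lambda>l. p l *\<^sub>R (shuffle_sign {\<tau>} ?K *\<^sub>R axis (UNIV - {j}) 1)
     + q l *\<^sub>R (shuffle_sign {j} ?K *\<^sub>R axis (UNIV - {\<tau>}) 1)) x"
    unfolding psi_form_eq[OF assms(1), abs_def]
    by (intro has_grad_add has_grad_bounded_linear[OF bounded_linear_scaleR_left] assms(2,3))
  then have "ext_deriv (psi_form V L \<tau> j) x = (\<Sum>l\<in>UNIV. (p l * shuffle_sign {\<tau>} ?K) *\<^sub>R (dx l \<and>\<^sub>w axis (UNIV - {j}) 1))
     + (\<Sum>l\<in>UNIV. (q l * shuffle_sign {j} ?K) *\<^sub>R (dx l \<and>\<^sub>w axis (UNIV - {\<tau>}) 1))"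
    by (simp add: ext_deriv_def has_grad_partial wedge.add_right wedge.scaleR_right sum.distrib)
  also have "(\<Sum>l\<in>UNIV. c l *\<^sub>R (dx l \<and>\<^sub>w axis (UNIV - {k}) 1)) = (c k * shuffle_sign {k} (UNIV - {k})) *\<^sub>R axis UNIV 1"
    for c :: "'n \<Rightarrow> real" and k
  proof -
    have "(\<Sum>l\<in>UNIV. c l *\<^sub>R (dx l \<and>\<^sub>w axis (UNIV - {k}) 1)) = (\<Sum>l\<in>{k}. c l *\<^sub>R (dx l \<and>\<^sub>w axis (UNIV - {k}) 1))"
      by (rule sum.mono_neutral_right) (auto simp: dx_wedge_axis)
    then show ?thesis by (simp add: dx_wedge_axis)
  qed
  then have "(\<Sum>l\<in>UNIV. (p l * shuffle_sign {\<tau>} ?K) *\<^sub>R (dx l \<and>\<^sub>w axis (UNIV - {j}) 1))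
     + (\<Sum>l\<in>UNIV. (q l * shuffle_sign {j} ?K) *\<^sub>R (dx l \<and>\<^sub>w axis (UNIV - {\<tau>}) 1))
     = (p j * (shuffle_sign {\<tau>} ?K * shuffle_sign {j} (UNIV - {j}))
        + q \<tau> * (shuffle_sign {j} ?K * shuffle_sign {\<tau>} (UNIV - {\<tau>}))) *\<^sub>R axis UNIV 1"
    by (simp add: scaleR_left_distrib mult.assoc)
  finally show ?thesis
    unfolding shuffle_sign_swap[OF assms(1)] by (simp add: algebra_simps)
qed

lemma frame_conservation_law:
  fixes V :: "'n::{finite,linorder} rvec \<Rightarrow> 'n rvec"
  assumes N: "open N" "N \<subseteq> U" and U: "open U" and I: "IGSGE U V h" and L: "frame_system N V h L"
    and j: "j \<noteq> \<tau>" 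
  shows "x \<in> N \<Longrightarrow> partial \<tau> (\<lambda>y. L y $ first $ j * V y $ j) x - partial j (\<lambda>y. L y $ first $ \<tau> * V y $ \<tau>) x = 0"
    and "closed_form_on N (CARD('n) - 1) (psi_form V L \<tau> j)"
proof -
  note sm = IGSGE_smooth_subset[OF I N(2)]
  have gf: "has_grad (\<lambda>y. L y $ first $ k * V y $ k)
      (\<lambda>s. frame_rhs s (V x) (h x) (L x) first $ k * V x $ k + L x $ first $ k * partial s V x $ k) x"
    if "x \<in> N" for x k
    using L that by (intro has_grad_bounded_bilinear[OF bounded_bilinear_mult] has_grad_nth
        differentiable_on_has_grad[OF N(1)] smooth_on_differentiable sm) (auto simp: frame_system_def)
  have dV: "partial s V x $ i = V x $ s * h x $ s $ i" if "i \<noteq> s" "x \<in> N" for s i x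
  proof -
    have "partial s V x $ i = partial s (\<lambda>y. V y $ i) x"
      by (rule has_grad_partial[OF has_grad_nth, symmetric])
        (use N(1) sm that in \<open>auto intro!: differentiable_on_has_grad smooth_on_differentiable\<close>)
    then show ?thesis using I N(2) that by (auto simp: IGSGE_def)
  qed
  have symm: "partial \<tau> (\<lambda>y. L y $ first $ j * V y $ j) x = partial j (\<lambda>y. L y $ first $ \<tau> * V y $ \<tau>) x"
    if "x \<in> N" for x
    unfolding has_grad_partial[OF gf[OF that]]
    using j that by (simp add: dV frame_rhs_def spin_def axis_def algebra_simps)
  then show "x \<in> N \<Longrightarrow> partial \<tau> (\<lambda>y. L y $ first $ j * V y $ j) x - partial j (\<lambda>y. L y $ first $ \<tau> * V y $ \<tau>) x = 0"
    by simp
  have "smooth_on N L" by (rule frame_system_smooth[OF N(1) sm L])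
  then have "smooth_on N (psi_form V L \<tau> j)"
    using sm unfolding smooth_on_iff psi_form_eq[OF j, abs_def]
    by (auto intro!: diff_order_add diff_order_scaleR diff_order_mult diff_order_nth diff_order_const N(1))
  moreover have "psi_form V L \<tau> j x $ I = 0" if "card I \<noteq> CARD('n) - 1" for x I
  proof -
    have "card (UNIV - {k}) = CARD('n) - 1" for k :: 'n by (simp add: card_Diff_singleton)
    then have "I \<noteq> UNIV - {k}" for k using that by metis
    then have "axis (UNIV - {k}) (1::real) $ I = 0" for k by (simp add: axis_def)
    then show ?thesis by (simp add: psi_form_eq[OF j])
  qed
  moreover have "ext_deriv (psi_form V L \<tau> j) x = 0" if "x \<in> N" for x
    using ext_deriv_psi_form[OF j gf gf, OF that that] symm[OF that]
    by (simp add: has_grad_partial[OF gf[OF that]])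
  ultimately show "closed_form_on N (CARD('n) - 1) (psi_form V L \<tau> j)"
    by (simp add: closed_form_on_def form_on_def)
qed

section \<open>Local existence, uniqueness and the conservation laws\<close>

theorem theorem5:
  fixes U :: "'n::{finite,linorder} rvec set"
    and V :: "'n rvec \<Rightarrow> 'n rvec"
    and h :: "'n rvec \<Rightarrow> 'n rmat"
    and \<tau> :: 'n
    and x0 :: "'n rvec"
    and L0 :: "'n rmat"
  assumes "CARD('n) \<ge> 2"
    and "open U"
    and "IGSGE U V h"
    and "\<forall>x\<in>U. \<forall>i. V x $ i \<noteq> 0"
    and "x0 \<in> U"
    and "orthogonal_matrix L0"
  shows "card {j. j \<noteq> \<tau>} = CARD('n) - 1 \<and>
         (\<exists>N L. open N \<and> connected N \<and> x0 \<in> N \<and> N \<subseteq> U \<and>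
           smooth_on N L \<and> L_system N V h L \<and> L x0 = L0 \<and>
           (\<forall>M L'. open M \<and> connected M \<and> x0 \<in> M \<and> M \<subseteq> N \<and> L_system M V h L' \<and> L' x0 = L0
              \<longrightarrow> (\<forall>x\<in>M. L' x = L x)) \<and>
           (\<forall>j. j \<noteq> \<tau> \<longrightarrow>
              closed_form_on N (CARD('n) - 1) (psi_form V L \<tau> j) \<and>
              (\<forall>x\<in>N. partial \<tau> (\<lambda>y. L y $ first $ j * V y $ j) x
                      - partial j (\<lambda>y. L y $ first $ \<tau> * V y $ \<tau>) x = 0)))"
proof
  have "{j. j \<noteq> \<tau>} = UNIV - {\<tau>}" by auto
  then show "card {j. j \<noteq> \<tau>} = CARD('n) - 1" by (simp add: card_Diff_singleton)
  obtain \<rho> L where \<rho>: "0 < \<rho>" "ball x0 \<rho> \<subseteq> U" and L: "frame_system (ball x0 \<rho>) V h L" and Lx0: "L x0 = L0"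
    using frame_system_exists[OF assms(2,5,3,6)] .
  define N where "N = ball x0 \<rho>"
  have N: "open N" "connected N" "x0 \<in> N" "N \<subseteq> U" and L: "frame_system N V h L"
    using \<rho> L by (auto simp: N_def)
  have unit: "V x \<bullet> V x = 1" if "x \<in> U" for x
    using assms(3) that by (simp add: IGSGE_def inner_vec_def)
  note sm = IGSGE_smooth_subset[OF assms(3) N(4)]
  show "\<exists>N L. open N \<and> connected N \<and> x0 \<in> N \<and> N \<subseteq> U \<and>
           smooth_on N L \<and> L_system N V h L \<and> L x0 = L0 \<and>
           (\<forall>M L'. open M \<and> connected M \<and> x0 \<in> M \<and> M \<subseteq> N \<and> L_system M V h L' \<and> L' x0 = L0
              \<longrightarrow> (\<forall>x\<in>M. L' x = L x)) \<and>
           (\<forall>j. j \<noteq> \<tau> \<longrightarrow>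
              closed_form_on N (CARD('n) - 1) (psi_form V L \<tau> j) \<and>
              (\<forall>x\<in>N. partial \<tau> (\<lambda>y. L y $ first $ j * V y $ j) x
                      - partial j (\<lambda>y. L y $ first $ \<tau> * V y $ \<tau>) x = 0))"
  proof (intro exI[of _ N] exI[of _ L] conjI allI impI ballI)
    show "smooth_on N L" by (rule frame_system_smooth[OF N(1) sm L])
    show "L_system N V h L" using L by (simp add: L_system_iff_frame_system[OF N(1)])
  next
    fix M L' x
    assume M: "open M \<and> connected M \<and> x0 \<in> M \<and> M \<subseteq> N \<and> L_system M V h L' \<and> L' x0 = L0" and x: "x \<in> M"
    show "L' x = L x"
    proof (rule frame_system_unique[where M = M and V = V and h = h])
      show "frame_system M V h L'" using M L_system_iff_frame_system by blast
      show "frame_system M V h L" using L M by (auto simp: frame_system_def)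
      show "V y \<bullet> V y = 1" if "y \<in> M" for y using that M N(4) unit by blast
      show "L' x0 = L x0" using M Lx0 by simp
    qed (use M x in auto)
  next
    fix j assume j: "j \<noteq> \<tau>"
    show "closed_form_on N (CARD('n) - 1) (psi_form V L \<tau> j)"
      by (rule frame_conservation_law(2)[OF N(1,4) assms(2,3) L j])
    show "partial \<tau> (\<lambda>y. L y $ first $ j * V y $ j) x
        - partial j (\<lambda>y. L y $ first $ \<tau> * V y $ \<tau>) x = 0" if "x \<in> N" for x
      by (rule frame_conservation_law(1)[OF N(1,4) assms(2,3) L j that])
  qed (fact N Lx0)+
qed

end
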